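(* Let $\mathcal K$ be a separable Hilbert space and let $T\in B(\mathcal K\otimes\bigotimes_{s=1}^kF^2(H_{n_s}))$. Then the following statements are equivalent. (i) $T$ satisfies the Brown-Halmos condition. (ii) $T$ is a weighted multi-Toeplitz operator.
   Context: Fix $k\in\mathbb N=\{1,2,\ldots\}$ and $\mathbf m=(m_1,\ldots,m_k)$, $\mathbf n=(n_1,\ldots,n_k)$ with $m_i,n_i\in\mathbb N$. For each $i$, $\mathbb F_{n_i}^+$ is the unital free semigroup with generators $g_1^i,\ldots,g_{n_i}^i$ and identity $g_0^i$; $|\alpha|$ is the length of $\alpha$. $F^2(H_{n_i})=\bigoplus_{p\ge0}H_{n_i}^{\otimes p}$ is the full Fock space of the Hilbert space $H_{n_i}$ with orthonormal basis $e_1^i,\ldots,e_{n_i}^i$; it has orthonormal basis $\{e_\alpha^i\}_{\alpha\in\mathbb F_{n_i}^+}$, $e^i_\alpha=e^i_{j_1}\otimes\cdots\otimes e^i_{j_p}$ for $\alpha=g^i_{j_1}\cdots g^i_{j_p}$, $e^i_{g_0^i}=1$. $\mathbf F_{\mathbf n}^+:=\mathbb F_{n_1}^+\times\cdots\times\mathbb F_{n_k}^+$ and $e_{\boldsymbol\alpha}:=e_{\alpha_1}^1\otimes\cdots\otimes e^k_{\alpha_k}$. Brown-Halmos condition: let $D_{i,j}e_\alpha^i:=\sqrt{\frac{|\alpha|+1}{|\alpha|+m_i}}\,e_\alpha^i$, $R_{i,j}f:=f\otimes e_j^i$, $\Lambda_{i,j}:=R_{i,j}D_{i,j}$ on $F^2(H_{n_i})$,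 and let $\boldsymbol\Lambda_{i,j}$ act on $\bigotimes_sF^2(H_{n_s})$ as $\Lambda_{i,j}$ on the $i$th factor and as the identity on the others. Put $\widetilde{\boldsymbol\Lambda}_{i,j}:=I_{\mathcal K}\otimes\boldsymbol\Lambda_{i,j}$, $\widetilde{\boldsymbol\Lambda}_{i,\beta}:=\widetilde{\boldsymbol\Lambda}_{i,j_1}\cdots\widetilde{\boldsymbol\Lambda}_{i,j_p}$ for $\beta=g^i_{j_1}\cdots g^i_{j_p}$, $\widetilde{\boldsymbol\Lambda}_{i,g_0^i}:=I$; let $\widetilde{\boldsymbol\Lambda}_i:=[\widetilde{\boldsymbol\Lambda}_{i,1}\cdots\widetilde{\boldsymbol\Lambda}_{i,n_i}]$ be the row operator from the direct sum of $n_i$ copies of $\mathcal K\otimes\bigotimes_sF^2(H_{n_s})$ to $\mathcal K\otimes\bigotimes_sF^2(H_{n_s})$, and $\widetilde{\boldsymbol\Lambda}_i':=\widetilde{\boldsymbol\Lambda}_i(\widetilde{\boldsymbol\Lambda}_i^*\widetilde{\boldsymbol\Lambda}_i)^{-1}$ its Cauchy dual ($\widetilde{\boldsymbol\Lambda}_i^*\widetilde{\boldsymbol\Lambda}_i$ is invertible). $\mathbf{diag}_n(A)$ is the direct sum of $n$ copies of $A$. $T$ satisfies the Brown-Halmos condition if for every $i\in\{1,\ldots,k\}$ $$\widetilde{\boldsymbol\Lambda}_i^{\prime *}T\widetilde{\boldsymbol\Lambda}_i'=\mathbf{diag}_{n_i}\Big(\sum_{j=0}^{m_i-1}(-1)^j\binom{m_i}{j+1}\sum_{\beta\in\mathbb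 F_{n_i}^+,|\beta|=j}\widetilde{\boldsymbol\Lambda}_{i,\beta}T\widetilde{\boldsymbol\Lambda}_{i,\beta}^*\Big).$$ Weighted multi-Toeplitz operators: put $b_{i,\alpha}^{(m_i)}:=\binom{|\alpha|+m_i-1}{m_i-1}$. For $\omega,\gamma\in\mathbb F_{n_i}^+$ write $\omega\ge_r\gamma$ if $\omega=\sigma\gamma$ for some $\sigma\in\mathbb F_{n_i}^+$, and then $\omega\backslash_r\gamma:=\sigma$. $\boldsymbol\omega,\boldsymbol\gamma\in\mathbf F_{\mathbf n}^+$ are comparable if for each $i$ either $\omega_i\ge_r\gamma_i$ or $\gamma_i\ge_r\omega_i$ (max and min of $\omega_i,\gamma_i$ refer to $\ge_r$). $\mathcal C$ is the set of all comparable pairs $(\boldsymbol\omega,\boldsymbol\gamma)$. $\mathcal J\subset\mathcal C$ is the set of $(\boldsymbol\sigma,\boldsymbol\beta)$ for which there are $s_i\in\mathbb Z$ with $|\sigma_i|=\max\{s_i,0\}$, $|\beta_i|=\max\{-s_i,0\}$ for all $i$. The map $\mathbf s:\mathcal C\to\mathcal J$ is $\mathbf s(\boldsymbol\omega,\boldsymbol\gamma):=(\boldsymbol\sigma,\boldsymbol\beta)$ with $\sigma_i:=\omega_i\backslash_r\gamma_i$ if $\omega_i\ge_r\gamma_i$ and $\sigma_i:=g_0^i$ otherwise, $\beta_i:=\gamma_i\backslash_r\omega_i$ if $\gamma_i\ge_r\omega_i$ and $\beta_i:=g_0^i$ otherwise. Put $\tau_{(\boldsymbol\omega,\boldsymbol\gamma)}:=\prod_{i=1}^k\sqrt{b^{(m_i)}_{i,\min\{\omega_i,\gamma_i\}}/b^{(m_i)}_{i,\max\{\omega_i,\gamma_i\}}}$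 for $(\boldsymbol\omega,\boldsymbol\gamma)\in\mathcal C$. $T$ is weighted (right) multi-Toeplitz if there are operators $\{A_{(\boldsymbol\sigma,\boldsymbol\beta)}\}_{(\boldsymbol\sigma,\boldsymbol\beta)\in\mathcal J}\subset B(\mathcal K)$ such that for all $\boldsymbol\omega,\boldsymbol\gamma\in\mathbf F_{\mathbf n}^+$ and $x,y\in\mathcal K$, $\langle T(x\otimes e_{\boldsymbol\gamma}),y\otimes e_{\boldsymbol\omega}\rangle$ equals $\tau_{(\boldsymbol\omega,\boldsymbol\gamma)}\langle A_{\mathbf s(\boldsymbol\omega,\boldsymbol\gamma)}x,y\rangle$ if $(\boldsymbol\omega,\boldsymbol\gamma)\in\mathcal C$ and $0$ otherwise. *)

theory Defs
  imports "HOL-Analysis.Analysis" "HOL-Library.FuncSet" "HOL-Library.Sublist"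
begin

section \<open>Complex Hilbert spaces\<close>

text \<open>The inner product is linear in the first and conjugate-linear in the second argument.\<close>

class complex_inner = real_normed_vector +
  fixes scaleC :: "complex \<Rightarrow> 'a \<Rightarrow> 'a"  (infixr "*\<^sub>C" 75)
    and cinner :: "'a \<Rightarrow> 'a \<Rightarrow> complex"
  assumes scaleC_add_right: "c *\<^sub>C (x + y) = c *\<^sub>C x + c *\<^sub>C y"
    and scaleC_add_left: "(c + d) *\<^sub>C x = c *\<^sub>C x + d *\<^sub>C x"
    and scaleC_scaleC: "c *\<^sub>C d *\<^sub>C x = (c * d) *\<^sub>C x"
    and scaleR_scaleC: "r *\<^sub>R x = complex_of_real r *\<^sub>C x"
    and cinner_commute: "cinner x y = cnj (cinner y x)"
    and cinner_add_left: "cinner (x + y) z = cinner x z + cinner y z"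
    and cinner_scaleC_left: "cinner (c *\<^sub>C x) y = c * cinner x y"
    and cinner_self: "cinner x x = complex_of_real ((norm x)\<^sup>2)"

class chilbert_space = complex_inner + complete_space

instantiation complex :: chilbert_space
begin
definition scaleC_complex_def: "c *\<^sub>C (x::complex) = c * x"
definition cinner_complex_def: "cinner (x::complex) y = x * cnj y"
instance
  by standard
    (auto simp: scaleC_complex_def cinner_complex_def algebra_simps scaleR_conv_of_real
      complex_norm_square simp del: of_real_power)
end

lemma cinner_add_right: "cinner x (y + z) = cinner x y + cinner x z"
  by (metis cinner_commute cinner_add_left complex_cnj_add)

lemma cinner_scaleC_right: "cinner x (c *\<^sub>C y) = cnj c * cinner x y"
  by (metis cinner_commute cinner_scaleC_left complex_cnj_mult)

lemma scaleC_one [simp]: "1 *\<^sub>C x = x"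
  using scaleR_scaleC[of 1 x] by simp

lemma scaleC_zero_left [simp]: "0 *\<^sub>C x = 0"
  using scaleR_scaleC[of 0 x] by simp

lemma scaleC_zero_right [simp]: "c *\<^sub>C 0 = 0"
  using scaleC_add_right[of c 0 0] by simp

lemma cinner_zero_left [simp]: "cinner 0 x = 0"
  using cinner_add_left[of 0 0 x] by simp

lemma cinner_zero_right [simp]: "cinner x 0 = 0"
  by (metis cinner_commute cinner_zero_left complex_cnj_zero)

lemma norm_scaleC: "norm (c *\<^sub>C x) = cmod c * norm x"
proof -
  have "complex_of_real ((norm (c *\<^sub>C x))\<^sup>2) = c * cnj c * complex_of_real ((norm x)\<^sup>2)"
    unfolding cinner_self[symmetric] by (simp add: cinner_scaleC_left cinner_scaleC_right)
  also have "\<dots> = complex_of_real ((cmod c * norm x)\<^sup>2)"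
    by (simp add: complex_norm_square[symmetric] power_mult_distrib del: of_real_power
        flip: of_real_mult)
  finally have "(norm (c *\<^sub>C x))\<^sup>2 = (cmod c * norm x)\<^sup>2"
    using of_real_eq_iff by blast
  then show ?thesis
    by (simp add: norm_ge_zero)
qed

lemma norm_add_square: "(norm (x + y))\<^sup>2 = (norm x)\<^sup>2 + (norm y)\<^sup>2 + 2 * Re (cinner x y)"
proof -
  have "complex_of_real ((norm (x + y))\<^sup>2)
      = of_real ((norm x)\<^sup>2) + of_real ((norm y)\<^sup>2) + (cinner x y + cnj (cinner x y))"
    unfolding cinner_self[symmetric]
    by (simp add: cinner_add_left cinner_add_right cinner_commute[of y x])
  then have "Re (complex_of_real ((norm (x + y))\<^sup>2))
      = Re (of_real ((norm x)\<^sup>2) + of_real ((norm y)\<^sup>2) + (cinner x y + cnj (cinner x y)))"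
    by simp
  then show ?thesis by simp
qed

lemma cmod_cinner_le: "cmod (cinner x y) \<le> (norm x)\<^sup>2 + (norm y)\<^sup>2"
proof -
  define u where "u = (if cinner x y = 0 then 1 else - cnj (cinner x y) / cmod (cinner x y))"
  have u: "cmod u = 1"
    by (auto simp: u_def norm_divide)
  have "cinner (u *\<^sub>C x) y = - complex_of_real (cmod (cinner x y))"
    by (auto simp: u_def cinner_scaleC_left complex_norm_square[symmetric] power2_eq_square
        mult.commute[of "cnj _"] field_simps)
  moreover have "0 \<le> (norm (u *\<^sub>C x + y))\<^sup>2"
    by simp
  ultimately have "2 * cmod (cinner x y) \<le> (norm x)\<^sup>2 + (norm y)\<^sup>2"
    unfolding norm_add_square by (simp add: norm_scaleC u)
  then show ?thesis
    using norm_ge_zero[of "cinner x y"] by linarith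
qed

text \<open>
  Bounded linear operators between linear subspaces are represented by functions that are
  only constrained on the subspace they act on. In \<open>adj S S' A\<close>, the adjoint of \<open>A : S \<rightarrow> S'\<close>, the
  vector \<open>z\<close> is unique if \<open>S\<close> is a linear subspace, and it exists if moreover \<open>S\<close> is complete and
  \<open>A\<close> is linear and bounded on \<open>S\<close>.
\<close>

definition bounded_op :: "'a::complex_inner set \<Rightarrow> 'b::complex_inner set \<Rightarrow> ('a \<Rightarrow> 'b) \<Rightarrow> bool" where
  "bounded_op S S' A \<longleftrightarrow>
     A ` S \<subseteq> S' \<and>
     (\<forall>x\<in>S. \<forall>y\<in>S. A (x + y) = A x + A y) \<and>
     (\<forall>c. \<forall>x\<in>S. A (c *\<^sub>C x) = c *\<^sub>C A x) \<and>
     (\<exists>M. \<forall>x\<in>S. norm (A x) \<le> M * norm x)"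

definition adj :: "'a::complex_inner set \<Rightarrow> 'b::complex_inner set \<Rightarrow> ('a \<Rightarrow> 'b) \<Rightarrow> 'b \<Rightarrow> 'a" where
  "adj S S' A y = (THE z. z \<in> S \<and> (\<forall>x\<in>S. cinner (A x) y = cinner x z))"

section \<open>Square-summable families\<close>

typedef (overloaded) ('i, 'h::complex_inner) l2 =
    "{f :: 'i \<Rightarrow> 'h. (\<lambda>i. (norm (f i))\<^sup>2) summable_on UNIV}"
  morphisms l2_nth Abs_l2
  by (rule exI[of _ "\<lambda>_. 0"]) simp

notation l2_nth (infixl "$$" 90)

setup_lifting type_definition_l2

lemma l2_summable: "(\<lambda>i. (norm (f $$ i))\<^sup>2) summable_on A"
  using l2_nth[of f] summable_on_subset_banach[of _ UNIV A] by auto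

lemma l2_eqI: "(\<And>i. f $$ i = g $$ i) \<Longrightarrow> f = g"
  by (simp add: l2_nth_inject[symmetric] fun_eq_iff)

lemma Abs_l2_nth:
  "(\<lambda>i. (norm (f i))\<^sup>2) summable_on UNIV \<Longrightarrow> Abs_l2 f $$ i = f i"
  by (simp add: Abs_l2_inverse)

lemma l2_add_aux:
  fixes f g :: "'i \<Rightarrow> 'h::real_normed_vector"
  assumes f: "(\<lambda>i. (norm (f i))\<^sup>2) summable_on UNIV" and g: "(\<lambda>i. (norm (g i))\<^sup>2) summable_on UNIV"
  shows "(\<lambda>i. (norm (f i + g i))\<^sup>2) summable_on UNIV"
    and "sqrt (\<Sum>\<^sub>\<infinity>i. (norm (f i + g i))\<^sup>2)
           \<le> sqrt (\<Sum>\<^sub>\<infinity>i. (norm (f i))\<^sup>2) + sqrt (\<Sum>\<^sub>\<infinity>i. (norm (g i))\<^sup>2)" (is "_ \<le> ?N")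
proof -
  have *: "(\<Sum>i\<in>F. (norm (f i + g i))\<^sup>2) \<le> ?N\<^sup>2" if "finite F" for F
  proof -
    have "sqrt (\<Sum>i\<in>F. (norm (f i + g i))\<^sup>2) \<le> L2_set (\<lambda>i. norm (f i) + norm (g i)) F"
      unfolding L2_set_def
      by (intro real_sqrt_le_mono sum_mono power_mono norm_triangle_ineq norm_ge_zero)
    also have "\<dots> \<le> L2_set (\<lambda>i. norm (f i)) F + L2_set (\<lambda>i. norm (g i)) F"
      by (rule L2_set_triangle_ineq)
    also have "\<dots> \<le> ?N"
      unfolding L2_set_def using that
      by (intro add_mono real_sqrt_le_mono finite_sum_le_infsum f g) auto
    finally show ?thesis
      by (simp add: real_le_lsqrt sqrt_le_D)
  qed
  show s: "(\<lambda>i. (norm (f i + g i))\<^sup>2) summable_on UNIV"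
    by (rule nonneg_bdd_above_summable_on) (auto intro!: bdd_aboveI2[where M = "?N\<^sup>2"] *)
  have "(\<Sum>\<^sub>\<infinity>i. (norm (f i + g i))\<^sup>2) \<le> ?N\<^sup>2"
    by (rule infsum_le_finite_sums[OF s]) (rule *)
  then show "sqrt (\<Sum>\<^sub>\<infinity>i. (norm (f i + g i))\<^sup>2) \<le> ?N"
    by (intro real_le_lsqrt add_nonneg_nonneg real_sqrt_ge_zero infsum_nonneg) auto
qed

lemma l2_cinner_summable:
  fixes f g :: "'i \<Rightarrow> 'h::complex_inner"
  assumes "(\<lambda>i. (norm (f i))\<^sup>2) summable_on A" and "(\<lambda>i. (norm (g i))\<^sup>2) summable_on A"
  shows "(\<lambda>i. cinner (f i) (g i)) summable_on A"
proof -
  have "(\<lambda>i. cmod (cinner (f i) (g i))) summable_on A"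
    by (rule summable_on_comparison_test[OF summable_on_add[OF assms]])
      (auto simp: cmod_cinner_le)
  then show ?thesis
    by (rule abs_summable_summable)
qed

lemma l2_scale_summable:
  fixes f :: "'i \<Rightarrow> 'h::complex_inner"
  assumes "(\<lambda>i. (norm (f i))\<^sup>2) summable_on UNIV"
  shows "(\<lambda>i. (norm (c *\<^sub>C f i))\<^sup>2) summable_on UNIV"
  using summable_on_cmult_right[OF assms, of "(cmod c)\<^sup>2"]
  by (simp add: norm_scaleC power_mult_distrib)

instantiation l2 :: (type, complex_inner) complex_inner
begin

lift_definition zero_l2 :: "('a, 'b) l2" is "\<lambda>_. 0" by simp
lift_definition plus_l2 :: "('a, 'b) l2 \<Rightarrow> ('a, 'b) l2 \<Rightarrow> ('a, 'b) l2" is "\<lambda>f g i. f i + g i"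
  by (rule l2_add_aux)
lift_definition uminus_l2 :: "('a, 'b) l2 \<Rightarrow> ('a, 'b) l2" is "\<lambda>f i. - f i" by simp
lift_definition minus_l2 :: "('a, 'b) l2 \<Rightarrow> ('a, 'b) l2 \<Rightarrow> ('a, 'b) l2" is "\<lambda>f g i. f i - g i"
  subgoal for f g using l2_add_aux(1)[of f "\<lambda>i. - g i"] by simp
  done
lift_definition scaleC_l2 :: "complex \<Rightarrow> ('a, 'b) l2 \<Rightarrow> ('a, 'b) l2" is "\<lambda>c f i. c *\<^sub>C f i"
  by (rule l2_scale_summable)
definition scaleR_l2 :: "real \<Rightarrow> ('a, 'b) l2 \<Rightarrow> ('a, 'b) l2" where
  "scaleR_l2 r f = complex_of_real r *\<^sub>C f"
definition cinner_l2 :: "('a, 'b) l2 \<Rightarrow> ('a, 'b) l2 \<Rightarrow> complex" where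
  "cinner_l2 f g = (\<Sum>\<^sub>\<infinity>i. cinner (f $$ i) (g $$ i))"
definition norm_l2 :: "('a, 'b) l2 \<Rightarrow> real" where
  "norm_l2 f = sqrt (\<Sum>\<^sub>\<infinity>i. (norm (f $$ i))\<^sup>2)"
definition sgn_l2 :: "('a, 'b) l2 \<Rightarrow> ('a, 'b) l2" where
  "sgn_l2 f = inverse (norm f) *\<^sub>R f"
definition dist_l2 :: "('a, 'b) l2 \<Rightarrow> ('a, 'b) l2 \<Rightarrow> real" where
  "dist_l2 f g = norm (f - g)"
definition uniformity_l2 :: "(('a, 'b) l2 \<times> ('a, 'b) l2) filter" where
  "uniformity_l2 = (INF e\<in>{0<..}. principal {(x, y). dist x y < e})"
definition open_l2 :: "('a, 'b) l2 set \<Rightarrow> bool" where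
  "open_l2 U = (\<forall>x\<in>U. \<forall>\<^sub>F (x', y) in uniformity. x' = x \<longrightarrow> y \<in> U)"

lemma l2_nth_simps [simp]:
  "(0 :: ('a, 'b) l2) $$ i = 0" "(f + g) $$ i = f $$ i + g $$ i"
  "(- f) $$ i = - (f $$ i)" "(f - g) $$ i = f $$ i - g $$ i"
  "(c *\<^sub>C f) $$ i = c *\<^sub>C (f $$ i)" for f g :: "('a, 'b) l2"
  by (transfer; simp)+

instance
proof
  fix f g h :: "('a, 'b) l2" and r s :: real and c d :: complex
  show "f + g + h = f + (g + h)" "f + g = g + f" "0 + f = f" "- f + f = 0" "f - g = f + - g"
    by (auto intro!: l2_eqI)
  show "r *\<^sub>R (f + g) = r *\<^sub>R f + r *\<^sub>R g" "(r + s) *\<^sub>R f = r *\<^sub>R f + s *\<^sub>R f"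
    "r *\<^sub>R s *\<^sub>R f = (r * s) *\<^sub>R f" "1 *\<^sub>R f = f"
    by (auto intro!: l2_eqI simp: scaleR_l2_def scaleC_add_right scaleC_add_left scaleC_scaleC)
  show "dist f g = norm (f - g)" by (rule dist_l2_def)
  show "sgn f = inverse (norm f) *\<^sub>R f" by (rule sgn_l2_def)
  show "uniformity = (INF e\<in>{0<..}. principal {(x, y::('a, 'b) l2). dist x y < e})"
    by (rule uniformity_l2_def)
  show "open U = (\<forall>x\<in>U. \<forall>\<^sub>F (x', y) in uniformity. x' = x \<longrightarrow> y \<in> U)" for U :: "('a, 'b) l2 set"
    by (rule open_l2_def)
  show "norm f = 0 \<longleftrightarrow> f = 0"
  proof
    assume "norm f = 0"
    then have z: "(\<Sum>\<^sub>\<infinity>i. (norm (f $$ i))\<^sup>2) = 0"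
      by (simp add: norm_l2_def)
    have "(norm (f $$ i))\<^sup>2 = 0" for i
      by (rule nonneg_infsum_le_0D[OF eq_refl[OF z] l2_summable]) auto
    then show "f = 0"
      by (auto intro: l2_eqI)
  qed (simp add: norm_l2_def)
  show "norm (f + g) \<le> norm f + norm g"
    unfolding norm_l2_def l2_nth_simps by (rule l2_add_aux(2)) (rule l2_summable)+
  have "norm (c *\<^sub>C f) = cmod c * norm f"
    by (simp add: norm_l2_def norm_scaleC power_mult_distrib infsum_cmult_right l2_summable
        real_sqrt_mult)
  then show "norm (r *\<^sub>R f) = \<bar>r\<bar> * norm f"
    by (simp add: norm_l2_def scaleR_l2_def norm_scaleC power_mult_distrib infsum_cmult_right
        l2_summable real_sqrt_mult)
  show "c *\<^sub>C (f + g) = c *\<^sub>C f + c *\<^sub>C g" "(c + d) *\<^sub>C f = c *\<^sub>C f + d *\<^sub>C f"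
    "c *\<^sub>C d *\<^sub>C f = (c * d) *\<^sub>C f"
    by (auto intro!: l2_eqI simp: scaleC_add_right scaleC_add_left scaleC_scaleC)
  show "r *\<^sub>R f = complex_of_real r *\<^sub>C f" by (rule scaleR_l2_def)
  show "cinner f g = cnj (cinner g f)"
    unfolding cinner_l2_def infsum_cnj[symmetric] by (rule infsum_cong) (rule cinner_commute)
  show "cinner (f + g) h = cinner f h + cinner g h"
    unfolding cinner_l2_def l2_nth_simps cinner_add_left
    by (rule infsum_add) (intro l2_cinner_summable l2_summable)+
  show "cinner (c *\<^sub>C f) g = c * cinner f g"
    unfolding cinner_l2_def l2_nth_simps cinner_scaleC_left
    by (rule infsum_cmult_right) (intro l2_cinner_summable l2_summable)
  have "0 \<le> (\<Sum>\<^sub>\<infinity>i. (norm (f $$ i))\<^sup>2)"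
    by (rule infsum_nonneg) simp
  moreover have "cinner f f = complex_of_real (\<Sum>\<^sub>\<infinity>i. (norm (f $$ i))\<^sup>2)"
    unfolding cinner_l2_def cinner_self by (intro infsumI has_sum_of_real has_sum_infsum l2_summable)
  ultimately show "cinner f f = complex_of_real ((norm f)\<^sup>2)"
    by (simp add: norm_l2_def)
qed

end

lemma norm_l2_nth_le: "norm (f $$ i) \<le> norm f"
proof -
  have "(\<Sum>i\<in>{i}. (norm (f $$ i))\<^sup>2) \<le> (\<Sum>\<^sub>\<infinity>i. (norm (f $$ i))\<^sup>2)"
    by (rule finite_sum_le_infsum) (auto simp: l2_summable)
  then show ?thesis
    by (simp add: norm_l2_def real_le_rsqrt)
qed

instance l2 :: (type, chilbert_space) chilbert_space
proof
  fix X :: "nat \<Rightarrow> ('a, 'b) l2"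
  assume C: "Cauchy X"
  have "Cauchy (\<lambda>n. X n $$ i)" for i
  proof (rule metric_CauchyI)
    fix e :: real
    assume "0 < e"
    then obtain M where M: "\<And>m n. m \<ge> M \<Longrightarrow> n \<ge> M \<Longrightarrow> norm (X m - X n) < e"
      using metric_CauchyD[OF C] unfolding dist_norm by blast
    have "dist (X m $$ i) (X n $$ i) < e" if "m \<ge> M" "n \<ge> M" for m n
      using norm_l2_nth_le[of "X m - X n" i] M[OF that] by (simp add: dist_norm)
    then show "\<exists>M. \<forall>m\<ge>M. \<forall>n\<ge>M. dist (X m $$ i) (X n $$ i) < e"
      by blast
  qed
  then have conv: "convergent (\<lambda>n. X n $$ i)" for i
    by (rule Cauchy_convergent)
  define g where "g = (\<lambda>i. lim (\<lambda>n. X n $$ i))"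
  have g: "(\<lambda>n. X n $$ i) \<longlonglongrightarrow> g i" for i
    using conv[of i] unfolding g_def convergent_LIMSEQ_iff .
  have tail: "\<exists>M. \<forall>m\<ge>M. \<forall>F. finite F \<longrightarrow> (\<Sum>i\<in>F. (norm (X m $$ i - g i))\<^sup>2) \<le> e\<^sup>2" if e: "0 < e" for e
  proof -
    obtain M where M: "\<And>m n. m \<ge> M \<Longrightarrow> n \<ge> M \<Longrightarrow> norm (X m - X n) < e"
      using metric_CauchyD[OF C e] by (auto simp: dist_norm)
    have "(\<Sum>i\<in>F. (norm (X m $$ i - g i))\<^sup>2) \<le> e\<^sup>2" if "m \<ge> M" "finite F" for m F
    proof (rule tendsto_upperbound)
      show "(\<lambda>n. \<Sum>i\<in>F. (norm (X m $$ i - X n $$ i))\<^sup>2) \<longlonglongrightarrow> (\<Sum>i\<in>F. (norm (X m $$ i - g i))\<^sup>2)"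
        by (intro tendsto_intros g)
      have "(\<Sum>i\<in>F. (norm (X m $$ i - X n $$ i))\<^sup>2) \<le> e\<^sup>2" if "n \<ge> M" for n
      proof -
        have "(\<Sum>i\<in>F. (norm ((X m - X n) $$ i))\<^sup>2) \<le> (\<Sum>\<^sub>\<infinity>i. (norm ((X m - X n) $$ i))\<^sup>2)"
          by (rule finite_sum_le_infsum[OF l2_summable \<open>finite F\<close>]) auto
        also have "\<dots> = (norm (X m - X n))\<^sup>2"
          unfolding norm_l2_def by (rule real_sqrt_pow2[symmetric]) (rule infsum_nonneg, simp)
        also have "\<dots> \<le> e\<^sup>2"
          using M[OF \<open>m \<ge> M\<close> that] by (intro power_mono) auto
        finally show ?thesis by simp
      qed
      then show "\<forall>\<^sub>F n in sequentially. (\<Sum>i\<in>F. (norm (X m $$ i - X n $$ i))\<^sup>2) \<le> e\<^sup>2"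
        unfolding eventually_sequentially by blast
    qed simp
    then show ?thesis by blast
  qed
  have summ: "(\<lambda>i. (norm (X m $$ i - g i))\<^sup>2) summable_on UNIV"
    if "\<And>F. finite F \<Longrightarrow> (\<Sum>i\<in>F. (norm (X m $$ i - g i))\<^sup>2) \<le> e\<^sup>2" for m e
    by (rule nonneg_bdd_above_summable_on) (auto intro!: bdd_aboveI2[where M = "e\<^sup>2"] that)
  obtain M1 where "\<And>F. finite F \<Longrightarrow> (\<Sum>i\<in>F. (norm (X M1 $$ i - g i))\<^sup>2) \<le> 1\<^sup>2"
    using tail[of 1] by auto
  from l2_add_aux(1)[OF l2_summable[of "- X M1"] summ[OF this]]
  have "(\<lambda>i. (norm (g i))\<^sup>2) summable_on UNIV"
    by simp
  then have G: "Abs_l2 g $$ i = g i" for i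
    by (rule Abs_l2_nth)
  have "X \<longlonglongrightarrow> Abs_l2 g"
  proof (rule metric_LIMSEQ_I)
    fix e :: real
    assume e: "0 < e"
    obtain M where M: "\<And>m F. m \<ge> M \<Longrightarrow> finite F \<Longrightarrow> (\<Sum>i\<in>F. (norm (X m $$ i - g i))\<^sup>2) \<le> (e/2)\<^sup>2"
      using tail[of "e/2"] e by auto
    have "dist (X m) (Abs_l2 g) < e" if "m \<ge> M" for m
    proof -
      have "(\<Sum>\<^sub>\<infinity>i. (norm (X m $$ i - g i))\<^sup>2) \<le> (e/2)\<^sup>2"
        by (rule infsum_le_finite_sums[OF summ]) (rule M[OF that], assumption)+
      then have "norm (X m - Abs_l2 g) \<le> sqrt ((e/2)\<^sup>2)"
        unfolding norm_l2_def l2_nth_simps G by (rule real_sqrt_le_mono)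
      then show ?thesis
        using e by (simp add: dist_norm power_divide real_sqrt_divide)
    qed
    then show "\<exists>no. \<forall>n\<ge>no. dist (X n) (Abs_l2 g) < e" by blast
  qed
  then show "convergent X"
    by (rule convergentI)
qed

section \<open>Fock spaces and their tensor product\<close>

text \<open>
  The free semigroup on the generators \<open>1, \<dots>, n\<close> is the set of words over \<open>{1..n}\<close>, with
  concatenation as product. The full Fock space over an \<open>n\<close>-dimensional Hilbert space is
  realised on its orthonormal basis of words: the summand of tensor degree \<open>p\<close> is spanned by the
  words of length \<open>p\<close>.
\<close>

definition free_sg :: "nat \<Rightarrow> nat list set" where
  "free_sg n = lists {1..n}"

definition l2_on :: "'i set \<Rightarrow> ('i, 'h::complex_inner) l2 set" where
  "l2_on I = {f. \<forall>i. i \<notin> I \<longrightarrow> f $$ i = 0}"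

definition fock :: "nat \<Rightarrow> (nat list, complex) l2 set" where
  "fock n = l2_on (free_sg n)"

definition ket :: "'i \<Rightarrow> ('i, complex) l2" where
  "ket a = Abs_l2 (\<lambda>b. if b = a then 1 else 0)"

definition multi_sg :: "nat \<Rightarrow> (nat \<Rightarrow> nat) \<Rightarrow> (nat \<Rightarrow> nat list) set" where
  "multi_sg k n = (\<Pi>\<^sub>E i\<in>{1..k}. free_sg (n i))"

text \<open>
  The Hilbert space tensor product of \<open>K\<close> with \<open>fock (n 1), \<dots>, fock (n k)\<close>, as the space of
  square-summable \<open>K\<close>-valued families on the product of the free semigroups.
  The lemmas \<open>cinner_ptensor\<close> and \<open>ptensor_total\<close> below show that this is indeed the
  tensor product.
\<close>

definition tensor_space :: "nat \<Rightarrow> (nat \<Rightarrow> nat) \<Rightarrow> (nat \<Rightarrow> nat list, 'k::complex_inner) l2 set" where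
  "tensor_space k n = l2_on (multi_sg k n)"

definition ptensor ::
  "nat \<Rightarrow> (nat \<Rightarrow> nat) \<Rightarrow> 'k::complex_inner \<Rightarrow> (nat \<Rightarrow> (nat list, complex) l2) \<Rightarrow>
    (nat \<Rightarrow> nat list, 'k) l2" where
  "ptensor k n x f =
     Abs_l2 (\<lambda>\<alpha>. if \<alpha> \<in> multi_sg k n then (\<Prod>i\<in>{1..k}. f i $$ \<alpha> i) *\<^sub>C x else 0)"

lemma ket_nth [simp]: "ket a $$ b = (if b = a then 1 else 0)"
  unfolding ket_def
  by (rule Abs_l2_nth) (rule finite_nonzero_values_imp_summable_on, simp)

lemma ket_in_fock: "\<alpha> \<in> free_sg n \<Longrightarrow> ket \<alpha> \<in> fock n"
  by (auto simp: fock_def l2_on_def)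

lemma prod_summable_PiE:
  fixes h :: "'i \<Rightarrow> 'a \<Rightarrow> real"
  assumes "finite I" "\<And>i. i \<in> I \<Longrightarrow> h i summable_on B i" "\<And>i a. h i a \<ge> 0"
  shows "(\<lambda>g. \<Prod>i\<in>I. h i (g i)) summable_on PiE I B"
proof (cases "\<exists>i\<in>I. \<forall>a\<in>B i. h i a = 0")
  case True
  then have "(\<Prod>i\<in>I. h i (g i)) = 0" if "g \<in> PiE I B" for g
    using \<open>finite I\<close> that by (auto simp: PiE_iff)
  then show ?thesis
    using summable_on_cong[of "PiE I B" "\<lambda>g. \<Prod>i\<in>I. h i (g i)" "\<lambda>_. 0"] by auto
next
  case False
  have "infsum (h i) (B i) \<noteq> 0" if "i \<in> I" for i
    using nonneg_infsum_le_0D[of "h i" "B i"] assms(2)[OF that] assms(3) False that by auto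
  then have "infsum (\<lambda>g. \<Prod>i\<in>I. h i (g i)) (PiE I B) \<noteq> 0"
    using assms by (subst infsum_prod_PiE_abs) auto
  then show ?thesis
    using infsum_not_exists by blast
qed

lemma ptensor_nth:
  "ptensor k n x f $$ \<alpha> = (if \<alpha> \<in> multi_sg k n then (\<Prod>i\<in>{1..k}. f i $$ \<alpha> i) *\<^sub>C x else 0)"
proof -
  have "(\<lambda>\<alpha>. \<Prod>i\<in>{1..k}. (cmod (f i $$ \<alpha> i))\<^sup>2) summable_on multi_sg k n"
    unfolding multi_sg_def by (rule prod_summable_PiE) (auto simp: l2_summable)
  from summable_on_cmult_left[OF this, of "(norm x)\<^sup>2"]
  have "(\<lambda>\<alpha>. (norm ((\<Prod>i\<in>{1..k}. f i $$ \<alpha> i) *\<^sub>C x))\<^sup>2) summable_on multi_sg k n"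
    by (simp add: norm_scaleC power_mult_distrib prod_norm[symmetric] prod_power_distrib)
  then have "(\<lambda>\<alpha>. (norm (if \<alpha> \<in> multi_sg k n then (\<Prod>i\<in>{1..k}. f i $$ \<alpha> i) *\<^sub>C x else 0))\<^sup>2)
      summable_on UNIV"
    by (subst summable_on_cong_neutral) auto
  then show ?thesis
    unfolding ptensor_def by (rule Abs_l2_nth)
qed

lemma ptensor_in_tensor_space: "ptensor k n x f \<in> tensor_space k n"
  by (auto simp: tensor_space_def l2_on_def ptensor_nth)

lemma cinner_ptensor:
  assumes "\<And>i. i \<in> {1..k} \<Longrightarrow> f i \<in> fock (n i)" "\<And>i. i \<in> {1..k} \<Longrightarrow> g i \<in> fock (n i)"
  shows "cinner (ptensor k n x f) (ptensor k n y g) = cinner x y * (\<Prod>i\<in>{1..k}. cinner (f i) (g i))"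
proof -
  have abs: "(\<lambda>a. cmod (f i $$ a * cnj (g i $$ a))) summable_on free_sg (n i)" for i
    using l2_cinner_summable[OF l2_summable[of "f i"] l2_summable[of "g i"]]
    unfolding cinner_complex_def summable_on_iff_abs_summable_on_complex .
  have "cinner (ptensor k n x f) (ptensor k n y g)
      = (\<Sum>\<^sub>\<infinity>\<alpha>\<in>multi_sg k n. cinner x y * (\<Prod>i\<in>{1..k}. f i $$ \<alpha> i * cnj (g i $$ \<alpha> i)))"
    unfolding cinner_l2_def
    by (rule infsum_cong_neutral)
      (auto simp: ptensor_nth cinner_scaleC_left cinner_scaleC_right prod.distrib)
  also have "\<dots> = cinner x y * (\<Prod>i\<in>{1..k}. \<Sum>\<^sub>\<infinity>a\<in>free_sg (n i). f i $$ a * cnj (g i $$ a))"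
    unfolding infsum_cmult_right' multi_sg_def
    by (subst infsum_prod_PiE_abs) (auto simp: abs)
  also have "(\<Prod>i\<in>{1..k}. \<Sum>\<^sub>\<infinity>a\<in>free_sg (n i). f i $$ a * cnj (g i $$ a))
      = (\<Prod>i\<in>{1..k}. cinner (f i) (g i))"
    unfolding cinner_l2_def cinner_complex_def
    using assms by (intro prod.cong refl infsum_cong_neutral) (auto simp: fock_def l2_on_def)
  finally show ?thesis .
qed

lemma cinner_ptensor_ket:
  assumes "\<alpha> \<in> multi_sg k n"
  shows "cinner F (ptensor k n x (\<lambda>i. ket (\<alpha> i))) = cinner (F $$ \<alpha>) x"
proof -
  have z: "ptensor k n x (\<lambda>i. ket (\<alpha> i)) $$ \<beta> = 0" if "\<beta> \<noteq> \<alpha>" for \<beta>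
  proof (cases "\<beta> \<in> multi_sg k n")
    case True
    have "\<exists>i\<in>{1..k}. \<beta> i \<noteq> \<alpha> i"
      using PiE_ext[of \<beta> "{1..k}" "\<lambda>i. free_sg (n i)" \<alpha>] that assms True
      unfolding multi_sg_def by blast
    then have "(\<Prod>i\<in>{1..k}. ket (\<alpha> i) $$ \<beta> i) = 0"
      by (intro prod_zero) auto
    then show ?thesis
      by (simp only: ptensor_nth scaleC_zero_left if_cancel)
  qed (simp add: ptensor_nth)
  have "ptensor k n x (\<lambda>i. ket (\<alpha> i)) $$ \<alpha> = x"
    using assms by (simp add: ptensor_nth)
  then have "cinner F (ptensor k n x (\<lambda>i. ket (\<alpha> i)))
      = (\<Sum>\<^sub>\<infinity>\<beta>\<in>{\<alpha>}. cinner (F $$ \<beta>) x)"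
    unfolding cinner_l2_def
    by (intro infsum_cong_neutral) (auto simp: z)
  then show ?thesis by simp
qed

lemma ptensor_total:
  assumes "F \<in> tensor_space k n"
    and "\<And>x f. (\<And>i. i \<in> {1..k} \<Longrightarrow> f i \<in> fock (n i)) \<Longrightarrow> cinner F (ptensor k n x f) = 0"
  shows "F = 0"
proof (rule l2_eqI)
  fix \<alpha>
  show "F $$ \<alpha> = 0 $$ \<alpha>"
  proof (cases "\<alpha> \<in> multi_sg k n")
    case True
    have "cinner F (ptensor k n (F $$ \<alpha>) (\<lambda>i. ket (\<alpha> i))) = 0"
      using True by (intro assms(2) ket_in_fock) (auto simp: multi_sg_def)
    then have "cinner (F $$ \<alpha>) (F $$ \<alpha>) = 0"
      by (simp add: cinner_ptensor_ket[OF True])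
    then show ?thesis
      by (simp add: cinner_self)
  qed (use assms(1) in \<open>auto simp: tensor_space_def l2_on_def\<close>)
qed

section \<open>The operators \<open>\<Lambda>\<close>\<close>

text \<open>\<open>D_op m\<close> is the diagonal operator with \<open>e\<^sub>\<alpha> \<mapsto> D_coeff m \<alpha> e\<^sub>\<alpha>\<close>; it does not depend on the generator.\<close>

definition D_coeff :: "nat \<Rightarrow> nat list \<Rightarrow> complex" where
  "D_coeff m \<alpha> = complex_of_real (sqrt (real (length \<alpha> + 1) / real (length \<alpha> + m)))"

definition D_op :: "nat \<Rightarrow> (nat list, complex) l2 \<Rightarrow> (nat list, complex) l2" where
  "D_op m f = Abs_l2 (\<lambda>\<alpha>. D_coeff m \<alpha> * f $$ \<alpha>)"

text \<open>\<open>f \<mapsto> f \<otimes> e\<^sub>j\<close>, that is, \<open>e\<^sub>\<alpha> \<mapsto> e\<^bsub>\<alpha>g\<^sub>j\<^esub>\<close>.\<close>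

definition R_op :: "nat \<Rightarrow> (nat list, complex) l2 \<Rightarrow> (nat list, complex) l2" where
  "R_op j f = Abs_l2 (\<lambda>\<alpha>. if \<alpha> \<noteq> [] \<and> last \<alpha> = j then f $$ butlast \<alpha> else 0)"

definition Lam_op :: "nat \<Rightarrow> nat \<Rightarrow> (nat list, complex) l2 \<Rightarrow> (nat list, complex) l2" where
  "Lam_op m j = R_op j \<circ> D_op m"

text \<open>
  \<open>on_factor k n i A\<close> acts as \<open>A\<close> on the \<open>i\<close>-th Fock space and as the identity on \<open>K\<close> and on the other
  Fock spaces; it is given here through the matrix \<open>ket \<beta> \<mapsto> A (ket \<beta>)\<close> of \<open>A\<close>.
  For \<open>A = Lam_op m j\<close> see \<open>Lam_nth\<close> and \<open>Lam_ptensor\<close> below.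
\<close>

definition on_factor ::
  "nat \<Rightarrow> (nat \<Rightarrow> nat) \<Rightarrow> nat \<Rightarrow> ((nat list, complex) l2 \<Rightarrow> (nat list, complex) l2) \<Rightarrow>
    (nat \<Rightarrow> nat list, 'k::complex_inner) l2 \<Rightarrow> (nat \<Rightarrow> nat list, 'k) l2" where
  "on_factor k n i A F =
     Abs_l2 (\<lambda>\<alpha>. if \<alpha> \<in> multi_sg k n
       then \<Sum>\<^sub>\<infinity>\<beta>\<in>free_sg (n i). (A (ket \<beta>) $$ \<alpha> i) *\<^sub>C (F $$ (\<alpha>(i := \<beta>))) else 0)"

definition Lam ::
  "nat \<Rightarrow> (nat \<Rightarrow> nat) \<Rightarrow> (nat \<Rightarrow> nat) \<Rightarrow> nat \<Rightarrow> nat \<Rightarrow>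
    (nat \<Rightarrow> nat list, 'k::complex_inner) l2 \<Rightarrow> (nat \<Rightarrow> nat list, 'k) l2" where
  "Lam k m n i j = on_factor k n i (Lam_op (m i) j)"

definition Lam_word ::
  "nat \<Rightarrow> (nat \<Rightarrow> nat) \<Rightarrow> (nat \<Rightarrow> nat) \<Rightarrow> nat \<Rightarrow> nat list \<Rightarrow>
    (nat \<Rightarrow> nat list, 'k::complex_inner) l2 \<Rightarrow> (nat \<Rightarrow> nat list, 'k) l2" where
  "Lam_word k m n i \<beta> = foldr (\<circ>) (map (Lam k m n i) \<beta>) id"

lemma D_coeff_le: "m \<ge> 1 \<Longrightarrow> cmod (D_coeff m \<alpha>) \<le> 1"
  by (auto simp: D_coeff_def)

lemma D_op_nth: "m \<ge> 1 \<Longrightarrow> D_op m f $$ \<alpha> = D_coeff m \<alpha> * f $$ \<alpha>"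
  unfolding D_op_def
proof (rule Abs_l2_nth, rule summable_on_comparison_test[OF l2_summable[of f]])
  fix \<alpha> assume "m \<ge> 1"
  then show "(cmod (D_coeff m \<alpha> * f $$ \<alpha>))\<^sup>2 \<le> (cmod (f $$ \<alpha>))\<^sup>2"
    using D_coeff_le[of m \<alpha>]
    by (intro power_mono) (auto simp: norm_mult intro!: mult_left_le_one_le)
qed simp

lemma R_op_nth: "R_op j f $$ \<alpha> = (if \<alpha> \<noteq> [] \<and> last \<alpha> = j then f $$ butlast \<alpha> else 0)"
  unfolding R_op_def
proof (rule Abs_l2_nth)
  have inj: "inj (\<lambda>\<alpha>. \<alpha> @ [j])"
    by (auto simp: inj_def)
  have "(\<lambda>\<alpha>. (cmod (if \<alpha> \<noteq> [] \<and> last \<alpha> = j then f $$ butlast \<alpha> else 0))\<^sup>2)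
      summable_on range (\<lambda>\<alpha>. \<alpha> @ [j])"
    by (subst summable_on_reindex[OF inj]) (simp add: o_def l2_summable)
  then show "(\<lambda>\<alpha>. (cmod (if \<alpha> \<noteq> [] \<and> last \<alpha> = j then f $$ butlast \<alpha> else 0))\<^sup>2) summable_on UNIV"
    by (subst (asm) summable_on_cong_neutral) (auto simp: image_iff, metis append_butlast_last_id)
qed

lemma Lam_op_ket: "m \<ge> 1 \<Longrightarrow> Lam_op m j (ket \<alpha>) = D_coeff m \<alpha> *\<^sub>C ket (\<alpha> @ [j])"
  by (rule l2_eqI)
    (auto simp: Lam_op_def R_op_nth D_op_nth scaleC_complex_def butlast_append snoc_eq_iff_butlast)

lemma Lam_op_nth:
  "m \<ge> 1 \<Longrightarrow> Lam_op m j f $$ \<alpha> =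
     (if \<alpha> \<noteq> [] \<and> last \<alpha> = j then D_coeff m (butlast \<alpha>) * f $$ butlast \<alpha> else 0)"
  by (auto simp: Lam_op_def R_op_nth D_op_nth)

lemma multi_sg_upd:
  "\<alpha> \<in> multi_sg k n \<Longrightarrow> i \<in> {1..k} \<Longrightarrow> \<alpha>(i := \<beta>) \<in> multi_sg k n \<longleftrightarrow> \<beta> \<in> free_sg (n i)"
  by (auto simp: multi_sg_def PiE_iff extensional_def)

lemma butlast_free_sg: "\<alpha> \<in> free_sg n \<Longrightarrow> butlast \<alpha> \<in> free_sg n"
  by (auto simp: free_sg_def dest: in_set_butlastD)

lemma Lam_nth:
  assumes m: "m i \<ge> 1" and i: "i \<in> {1..k}"
  shows "Lam k m n i j F $$ \<alpha> =
    (if \<alpha> \<in> multi_sg k n \<and> \<alpha> i \<noteq> [] \<and> last (\<alpha> i) = j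
     then D_coeff (m i) (butlast (\<alpha> i)) *\<^sub>C (F $$ (\<alpha>(i := butlast (\<alpha> i)))) else 0)"
    (is "_ = ?G \<alpha>")
proof -
  have G: "(if \<alpha> \<in> multi_sg k n
      then \<Sum>\<^sub>\<infinity>\<beta>\<in>free_sg (n i). (Lam_op (m i) j (ket \<beta>) $$ \<alpha> i) *\<^sub>C (F $$ (\<alpha>(i := \<beta>))) else 0) = ?G \<alpha>"
    for \<alpha>
  proof (cases "\<alpha> \<in> multi_sg k n")
    case True
    then have "butlast (\<alpha> i) \<in> free_sg (n i)"
      using i by (intro butlast_free_sg) (auto simp: multi_sg_def)
    then have "(\<Sum>\<^sub>\<infinity>\<beta>\<in>free_sg (n i). (Lam_op (m i) j (ket \<beta>) $$ \<alpha> i) *\<^sub>C (F $$ (\<alpha>(i := \<beta>))))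
      = (\<Sum>\<^sub>\<infinity>\<beta>\<in>{butlast (\<alpha> i)}. (Lam_op (m i) j (ket \<beta>) $$ \<alpha> i) *\<^sub>C (F $$ (\<alpha>(i := \<beta>))))"
      by (intro infsum_cong_neutral) (auto simp: Lam_op_nth[OF m])
    then show ?thesis
      using True by (simp add: Lam_op_nth[OF m] del: fun_upd_apply)
  qed simp
  define S where "S = {\<alpha>. \<alpha> \<in> multi_sg k n \<and> \<alpha> i \<noteq> [] \<and> last (\<alpha> i) = j}"
  have "inj_on (\<lambda>\<alpha>. \<alpha>(i := butlast (\<alpha> i))) S"
  proof (rule inj_onI)
    fix \<alpha> \<beta>
    assume *: "\<alpha> \<in> S" "\<beta> \<in> S" "\<alpha>(i := butlast (\<alpha> i)) = \<beta>(i := butlast (\<beta> i))"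
    then have "butlast (\<alpha> i) = butlast (\<beta> i)"
      by (metis fun_upd_same)
    with * have "\<alpha> i = \<beta> i"
      by (metis (mono_tags, lifting) S_def append_butlast_last_id mem_Collect_eq)
    with * show "\<alpha> = \<beta>"
      by (metis fun_upd_triv fun_upd_upd)
  qed
  then have "(\<lambda>\<alpha>. (norm (F $$ (\<alpha>(i := butlast (\<alpha> i)))))\<^sup>2) summable_on S"
    using l2_summable[of F "(\<lambda>\<alpha>. \<alpha>(i := butlast (\<alpha> i))) ` S"]
    by (subst (asm) summable_on_reindex) (auto simp: o_def)
  then have "(\<lambda>\<alpha>. (norm (?G \<alpha>))\<^sup>2) summable_on S"
  proof (rule summable_on_comparison_test)
    fix \<alpha>
    show "(norm (?G \<alpha>))\<^sup>2 \<le> (norm (F $$ (\<alpha>(i := butlast (\<alpha> i)))))\<^sup>2"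
      using D_coeff_le[OF m, of "butlast (\<alpha> i)"]
      by (intro power_mono)
        (simp_all add: norm_scaleC mult_left_le_one_le del: fun_upd_apply)
  qed simp
  then have "(\<lambda>\<alpha>. (norm (?G \<alpha>))\<^sup>2) summable_on UNIV"
    by (subst (asm) summable_on_cong_neutral) (auto simp: S_def)
  then show ?thesis
    unfolding Lam_def on_factor_def G by (rule Abs_l2_nth)
qed

lemma Lam_ptensor:
  assumes m: "m i \<ge> 1" and i: "i \<in> {1..k}"
  shows "Lam k m n i j (ptensor k n x f) = ptensor k n x (f(i := Lam_op (m i) j (f i)))"
proof (rule l2_eqI)
  fix \<alpha>
  show "Lam k m n i j (ptensor k n x f) $$ \<alpha> = ptensor k n x (f(i := Lam_op (m i) j (f i))) $$ \<alpha>"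
  proof (cases "\<alpha> \<in> multi_sg k n")
    case True
    have split: "(\<Prod>s\<in>{1..k}. h s $$ \<beta> s) = h i $$ \<beta> i * (\<Prod>s\<in>{1..k} - {i}. h s $$ \<beta> s)"
      for h :: "nat \<Rightarrow> (nat list, complex) l2" and \<beta>
      using i by (intro prod.remove) auto
    have rest1: "(\<Prod>s\<in>{1..k} - {i}. f s $$ (\<alpha>(i := b)) s) = (\<Prod>s\<in>{1..k} - {i}. f s $$ \<alpha> s)" for b
      by (rule prod.cong) auto
    have rest2: "(\<Prod>s\<in>{1..k} - {i}. (f(i := g)) s $$ \<alpha> s) = (\<Prod>s\<in>{1..k} - {i}. f s $$ \<alpha> s)" for g
      by (rule prod.cong) auto
    have upd: "\<alpha>(i := butlast (\<alpha> i)) \<in> multi_sg k n"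
      unfolding multi_sg_upd[OF True i]
      using True i by (intro butlast_free_sg) (auto simp: multi_sg_def)
    have L: "ptensor k n x f $$ (\<alpha>(i := butlast (\<alpha> i)))
        = (f i $$ butlast (\<alpha> i) * (\<Prod>s\<in>{1..k} - {i}. f s $$ \<alpha> s)) *\<^sub>C x"
      using upd split[of f "\<alpha>(i := butlast (\<alpha> i))"] rest1 by (simp only: ptensor_nth if_True fun_upd_same)
    have R: "ptensor k n x (f(i := g)) $$ \<alpha>
        = (g $$ \<alpha> i * (\<Prod>s\<in>{1..k} - {i}. f s $$ \<alpha> s)) *\<^sub>C x" for g
      using True split[of "f(i := g)" \<alpha>] rest2 by (simp only: ptensor_nth if_True fun_upd_same)
    show ?thesis
      unfolding Lam_nth[where m = m and i = i, OF m i] R Lam_op_nth[OF m] L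
      using True by (simp add: scaleC_scaleC mult.assoc)
  qed (simp add: Lam_nth[where m = m and i = i, OF m i] ptensor_nth)
qed

section \<open>Cauchy dual and Brown-Halmos condition\<close>

text \<open>The direct sum of \<open>N\<close> copies of \<open>S\<close> consists of families indexed by \<open>{1..N}\<close>.\<close>

definition copies :: "nat \<Rightarrow> 'h::complex_inner set \<Rightarrow> (nat, 'h) l2 set" where
  "copies N S = {X \<in> l2_on {1..N}. \<forall>j\<in>{1..N}. X $$ j \<in> S}"

definition diag :: "nat \<Rightarrow> ('h::complex_inner \<Rightarrow> 'h) \<Rightarrow> (nat, 'h) l2 \<Rightarrow> (nat, 'h) l2" where
  "diag N A X = Abs_l2 (\<lambda>j. if j \<in> {1..N} then A (X $$ j) else 0)"

definition Lam_row ::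
  "nat \<Rightarrow> (nat \<Rightarrow> nat) \<Rightarrow> (nat \<Rightarrow> nat) \<Rightarrow> nat \<Rightarrow>
    (nat, (nat \<Rightarrow> nat list, 'k::complex_inner) l2) l2 \<Rightarrow> (nat \<Rightarrow> nat list, 'k) l2" where
  "Lam_row k m n i X = (\<Sum>j\<in>{1..n i}. Lam k m n i j (X $$ j))"

definition cauchy_dual ::
  "'a::complex_inner set \<Rightarrow> 'b::complex_inner set \<Rightarrow> ('a \<Rightarrow> 'b) \<Rightarrow> 'a \<Rightarrow> 'b" where
  "cauchy_dual S S' A = A \<circ> inv_into S (adj S S' A \<circ> A)"

definition brown_halmos ::
  "nat \<Rightarrow> (nat \<Rightarrow> nat) \<Rightarrow> (nat \<Rightarrow> nat) \<Rightarrow>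
    ((nat \<Rightarrow> nat list, 'k::complex_inner) l2 \<Rightarrow> (nat \<Rightarrow> nat list, 'k) l2) \<Rightarrow> bool" where
  "brown_halmos k m n T \<longleftrightarrow>
     (\<forall>i\<in>{1..k}.
        let H = tensor_space k n;
            HN = copies (n i) H;
            L' = cauchy_dual HN H (Lam_row k m n i)
        in \<forall>X\<in>HN. adj HN H L' (T (L' X)) =
             diag (n i) (\<lambda>F. \<Sum>j\<in>{0..m i - 1}. ((-1) ^ j * of_nat (m i choose (j + 1))) *\<^sub>C
               (\<Sum>\<beta> | \<beta> \<in> free_sg (n i) \<and> length \<beta> = j.
                  Lam_word k m n i \<beta> (T (adj H H (Lam_word k m n i \<beta>) F)))) X)"

section \<open>Weighted multi-Toeplitz operators\<close>

text \<open>
  The relation \<open>\<omega> \<ge>\<^sub>r \<gamma>\<close>, that is \<open>\<omega> = \<sigma>\<gamma>\<close> for some \<open>\<sigma>\<close>, is \<open>suffix \<gamma> \<omega>\<close>; then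
  \<open>rdiff \<omega> \<gamma>\<close> is \<open>\<sigma>\<close>. Maximum and minimum are only used for comparable words.
\<close>

definition rdiff :: "nat list \<Rightarrow> nat list \<Rightarrow> nat list" where
  "rdiff \<omega> \<gamma> = (THE \<sigma>. \<omega> = \<sigma> @ \<gamma>)"

definition rmax :: "nat list \<Rightarrow> nat list \<Rightarrow> nat list" where
  "rmax \<omega> \<gamma> = (if suffix \<gamma> \<omega> then \<omega> else \<gamma>)"

definition rmin :: "nat list \<Rightarrow> nat list \<Rightarrow> nat list" where
  "rmin \<omega> \<gamma> = (if suffix \<gamma> \<omega> then \<gamma> else \<omega>)"

definition b_weight :: "nat \<Rightarrow> nat list \<Rightarrow> real" where
  "b_weight m \<alpha> = real ((length \<alpha> + m - 1) choose (m - 1))"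

definition comparable_pairs ::
  "nat \<Rightarrow> (nat \<Rightarrow> nat) \<Rightarrow> ((nat \<Rightarrow> nat list) \<times> (nat \<Rightarrow> nat list)) set" where
  "comparable_pairs k n =
     {(\<omega>, \<gamma>). \<omega> \<in> multi_sg k n \<and> \<gamma> \<in> multi_sg k n \<and>
        (\<forall>i\<in>{1..k}. suffix (\<gamma> i) (\<omega> i) \<or> suffix (\<omega> i) (\<gamma> i))}"

definition J_pairs ::
  "nat \<Rightarrow> (nat \<Rightarrow> nat) \<Rightarrow> ((nat \<Rightarrow> nat list) \<times> (nat \<Rightarrow> nat list)) set" where
  "J_pairs k n =
     {(\<sigma>, \<beta>). (\<sigma>, \<beta>) \<in> comparable_pairs k n \<and>
        (\<exists>s :: nat \<Rightarrow> int. \<forall>i\<in>{1..k}.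
           int (length (\<sigma> i)) = max (s i) 0 \<and> int (length (\<beta> i)) = max (- s i) 0)}"

definition s_map ::
  "nat \<Rightarrow> (nat \<Rightarrow> nat list) \<Rightarrow> (nat \<Rightarrow> nat list) \<Rightarrow> (nat \<Rightarrow> nat list) \<times> (nat \<Rightarrow> nat list)" where
  "s_map k \<omega> \<gamma> =
     ((\<lambda>i\<in>{1..k}. if suffix (\<gamma> i) (\<omega> i) then rdiff (\<omega> i) (\<gamma> i) else []),
      (\<lambda>i\<in>{1..k}. if suffix (\<omega> i) (\<gamma> i) then rdiff (\<gamma> i) (\<omega> i) else []))"

definition tau ::
  "nat \<Rightarrow> (nat \<Rightarrow> nat) \<Rightarrow> (nat \<Rightarrow> nat list) \<Rightarrow> (nat \<Rightarrow> nat list) \<Rightarrow> real" where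
  "tau k m \<omega> \<gamma> =
     (\<Prod>i\<in>{1..k}. sqrt (b_weight (m i) (rmin (\<omega> i) (\<gamma> i)) / b_weight (m i) (rmax (\<omega> i) (\<gamma> i))))"

definition weighted_multi_Toeplitz ::
  "nat \<Rightarrow> (nat \<Rightarrow> nat) \<Rightarrow> (nat \<Rightarrow> nat) \<Rightarrow>
    ((nat \<Rightarrow> nat list, 'k::complex_inner) l2 \<Rightarrow> (nat \<Rightarrow> nat list, 'k) l2) \<Rightarrow> bool" where
  "weighted_multi_Toeplitz k m n T \<longleftrightarrow>
     (\<exists>A :: (nat \<Rightarrow> nat list) \<times> (nat \<Rightarrow> nat list) \<Rightarrow> 'k \<Rightarrow> 'k.
        (\<forall>p\<in>J_pairs k n. bounded_op UNIV UNIV (A p)) \<and>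
        (\<forall>\<omega>\<in>multi_sg k n. \<forall>\<gamma>\<in>multi_sg k n. \<forall>x y.
           cinner (T (ptensor k n x (\<lambda>i. ket (\<gamma> i)))) (ptensor k n y (\<lambda>i. ket (\<omega> i))) =
             (if (\<omega>, \<gamma>) \<in> comparable_pairs k n
              then complex_of_real (tau k m \<omega> \<gamma>) * cinner (A (s_map k \<omega> \<gamma>) x) y
              else 0)))"

end

theory Submission
  imports Defs
begin

text \<open>
  Write \<open>b\<close> for the weights \<open>b\<^sub>i\<close> and scale the matrix entries of \<open>T\<close> to
  \<open>U(\<omega>, \<gamma>) = \<Prod>\<^sub>i sqrt (b(\<omega>\<^sub>i) b(\<gamma>\<^sub>i)) T(\<omega>, \<gamma>)\<close>. All the weights of the shifts
  cancel, and the \<open>i\<close>-th Brown-Halmos equation becomes a linear recurrence in the \<open>i\<close>-th words: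
  \<open>U(\<omega>g\<^sub>j, \<gamma>g\<^sub>l)\<close> is \<open>0\<close> for \<open>j \<noteq> l\<close>, and for \<open>j = l\<close> it is the alternating sum of
  \<open>binom(m, p+1) U\<close> over the pairs obtained by stripping a common suffix of length \<open>p < m\<close>.
  Along a pair \<open>(\<omega>\<rho>, \<gamma>\<rho>)\<close> with \<open>\<omega>\<close>, \<open>\<gamma>\<close> having no common suffix, the recurrence has characteristic
  polynomial \<open>(1 - x)^m\<close> and the unique solution \<open>b(\<rho>) U(\<omega>, \<gamma>)\<close>; moreover \<open>U(\<omega>, \<gamma>) = 0\<close> when both
  words are nonempty. Applying this in each coordinate gives the multi-Toeplitz form, and the
  steps are reversible.
\<close>

section \<open>The coefficients of (1 - x)^(-m) and their recurrence\<close>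

section \<open>Binomial weights\<close>

text \<open>For m >= 1 this is the coefficient of x^q in (1 - x)^(-m): the weight
  \<open>b_weight\<close> as a function of the word length alone.\<close>

definition bw :: "nat \<Rightarrow> nat \<Rightarrow> real" where
  "bw m q = real ((q + m - 1) choose (m - 1))"

lemma b_weight_eq_bw: "b_weight m \<alpha> = bw m (length \<alpha>)"
  by (simp add: b_weight_def bw_def)

lemma bw_pos: "m \<ge> 1 \<Longrightarrow> bw m q > 0"
  by (simp add: bw_def)

lemma bw_0 [simp]: "bw m 0 = 1"
  by (simp add: bw_def)

lemma bw_Suc: "m \<ge> 1 \<Longrightarrow> (real q + 1) * bw m (Suc q) = (real q + real m) * bw m q"
proof -
  assume "m \<ge> 1"
  then obtain r where m: "m = Suc r" by (cases m) auto
  have "Suc q * (Suc (q + r) choose Suc q) = Suc (q + r) * ((q + r) choose q)"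
    by (metis Suc_times_binomial_eq mult.commute)
  moreover have "Suc (q + r) choose Suc q = Suc (q + r) choose r" "(q + r) choose q = (q + r) choose r"
    using binomial_symmetric[of "Suc q" "Suc (q + r)"] binomial_symmetric[of q "q + r"] by simp_all
  ultimately have "Suc q * (Suc (q + r) choose r) = Suc (q + r) * ((q + r) choose r)"
    by simp
  then have "real (Suc q * (Suc (q + r) choose r)) = real (Suc (q + r) * ((q + r) choose r))"
    by simp
  then show ?thesis
    by (simp add: bw_def m algebra_simps)
qed

text \<open>The right-hand side is the squared eigenvalue in \<open>D_coeff\<close>. Writing it as a
  quotient of consecutive weights is what makes products of shifts telescope.\<close>

lemma bw_ratio:
  assumes "m \<ge> 1"
  shows "bw m q / bw m (Suc q) = real (q + 1) / real (q + m)"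
  using bw_Suc[OF assms, of q] bw_pos[OF assms, of "Suc q"] assms by (simp add: field_simps)

text \<open>
  The coefficient of \<open>x^(q+1)\<close> in \<open>(1 - x)^m (1 - x)^(-m) = 1\<close>, solved for the leading term.
\<close>

lemma bw_recurrence:
  assumes m: "m \<ge> 1"
  shows "(\<Sum>p\<in>{0..m - 1}. (-1) ^ p * real (m choose (p + 1)) * (if p \<le> q then bw m (q - p) else 0))
    = bw m (Suc q)"
proof -
  \<comment> \<open>Upper negation: up to sign, the weights are the coefficients of (1 +
    x)^(-m).\<close>
  have neg: "(- real m) gchoose r = (-1) ^ r * bw m r" for r
  proof -
    have sym: "(r + m - 1) choose r = (r + m - 1) choose (m - 1)"
      using binomial_symmetric[of r "r + m - 1"] m by (simp only: diff_add_inverse diff_add_assoc le_add1)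
    have "real m + real r - 1 = real (r + m - 1)"
      using m by (simp add: of_nat_diff)
    then have "(- real m) gchoose r = (-1) ^ r * (real (r + m - 1) gchoose r)"
      using gbinomial_minus[of "real m" r] by metis
    also have "real (r + m - 1) gchoose r = bw m r"
      unfolding binomial_gbinomial[symmetric] sym bw_def ..
    finally show ?thesis .
  qed
  define g where "g p = (-1) ^ p * real (m choose p) * bw m (Suc q - p)" for p
  have g: "(-1) ^ Suc q * g p = (real m gchoose p) * ((- real m) gchoose (Suc q - p))" if le: "p \<le> Suc q" for p
  proof -
    obtain r where r: "Suc q = p + r"
      using le_Suc_ex[OF le] by blast
    have "(-1 :: real) ^ p * (-1) ^ p = 1"
      by (rule minus_one_mult_self)
    then show ?thesis
      unfolding neg g_def r power_add binomial_gbinomial[symmetric] by simp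
  qed
  \<comment> \<open>With the global sign (-1)^(q+1) the sum is a Vandermonde convolution for the
    exponents m and -m, so it equals a coefficient of positive index of (1 + x)^0.\<close>
  have "(-1) ^ Suc q * (\<Sum>p\<le>Suc q. g p) = (\<Sum>p\<le>Suc q. (real m gchoose p) * ((- real m) gchoose (Suc q - p)))"
    unfolding sum_distrib_left by (intro sum.cong refl g) auto
  also have "\<dots> = (0 :: real) gchoose Suc q"
    using gbinomial_Vandermonde[of "real m" "- real m" "Suc q"] by (simp add: atLeast0AtMost)
  finally have "(\<Sum>p\<le>Suc q. g p) = 0"
    by simp
  then have "bw m (Suc q) = (\<Sum>p\<le>q. - g (Suc p))"
    unfolding sum.atMost_Suc_shift by (simp add: g_def sum_negf)
  also have "\<dots> = (\<Sum>p\<le>q. (-1) ^ p * real (m choose (p + 1)) * bw m (q - p))"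
    by (simp add: g_def)
  \<comment> \<open>The two index ranges differ only in zero terms: the binomial coefficient
    vanishes for p >= m, the conditional for p > q.\<close>
  also have "\<dots> = (\<Sum>p\<in>{0..m - 1}. (-1) ^ p * real (m choose (p + 1)) * (if p \<le> q then bw m (q - p) else 0))"
    by (rule sum.mono_neutral_cong) (use m in \<open>auto simp: not_le intro!: binomial_eq_0\<close>)
  finally show ?thesis ..
qed

section \<open>Solving the recurrence along a common suffix, for a single pair of words\<close>

section \<open>The recurrence in one coordinate\<close>

text \<open>A common suffix longer than \<rho> would leave a nonempty common suffix of
  \<open>a\<close> and \<open>b\<close>, whose last letters would then agree. So \<rho> is the
  longest common suffix of the extended words.\<close>

lemma common_suffix_append_iff:
  assumes "a = [] \<or> b = [] \<or> last a \<noteq> last b"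
  shows "(\<exists>\<delta>. length \<delta> = p \<and> suffix \<delta> (a @ \<rho>) \<and> suffix \<delta> (b @ \<rho>)) \<longleftrightarrow> p \<le> length \<rho>"
proof
  assume "p \<le> length \<rho>"
  then show "\<exists>\<delta>. length \<delta> = p \<and> suffix \<delta> (a @ \<rho>) \<and> suffix \<delta> (b @ \<rho>)"
    by (intro exI[of _ "drop (length \<rho> - p) \<rho>"])
      (auto intro: suffix_appendI suffix_drop)
next
  assume "\<exists>\<delta>. length \<delta> = p \<and> suffix \<delta> (a @ \<rho>) \<and> suffix \<delta> (b @ \<rho>)"
  then obtain \<delta> where \<delta>: "length \<delta> = p" "suffix \<delta> (a @ \<rho>)" "suffix \<delta> (b @ \<rho>)" by blast
  show "p \<le> length \<rho>"
  proof (rule ccontr)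
    assume "\<not> p \<le> length \<rho>"
    then have "\<not> suffix \<delta> \<rho>"
      using \<delta>(1) suffix_length_le by blast
    then obtain c d where "\<delta> = c @ \<rho>" "suffix c a" "\<delta> = d @ \<rho>" "suffix d b"
      using \<delta>(2,3) unfolding suffix_append by blast
    moreover from this have "c \<noteq> []"
      using \<open>\<not> suffix \<delta> \<rho>\<close> by auto
    ultimately show False
      using assms by (auto simp: suffix_def)
  qed
qed

text \<open>Every pair of words is uniquely an extension by a common suffix \<rho> of a pair without
  common nonempty suffix. Along \<rho> the recurrence determines \<open>u\<close> from its value at
  that reduced pair, and \<open>bw_recurrence\<close> identifies the factor as
  \<open>bw m (length \<rho>)\<close>. If both reduced words are nonempty, their last letters differ
  and the case \<open>j \<noteq> l\<close> makes the value zero.\<close>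

lemma common_suffix_recurrence_iff:
  fixes u :: "'a list \<Rightarrow> 'a list \<Rightarrow> 'v::real_vector"
  assumes m: "m \<ge> 1"
  shows "(\<forall>a\<in>lists A. \<forall>b\<in>lists A. \<forall>j\<in>A. \<forall>l\<in>A. u (a @ [j]) (b @ [l]) =
      (if j = l then \<Sum>p\<in>{0..m - 1}. ((-1) ^ p * real (m choose (p + 1))) *\<^sub>R
          (if \<exists>\<delta>. length \<delta> = p \<and> suffix \<delta> a \<and> suffix \<delta> b
           then u (take (length a - p) a) (take (length b - p) b) else 0)
       else 0)) \<longleftrightarrow>
    (\<forall>a\<in>lists A. \<forall>b\<in>lists A. u a b =
      (if suffix b a then bw m (length b) *\<^sub>R u (take (length a - length b) a) []
       else if suffix a b then bw m (length a) *\<^sub>R u [] (take (length b - length a) b)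
       else 0))"
    (is "?L \<longleftrightarrow> ?R")
proof -
  let ?red = "\<lambda>a b. a = [] \<or> b = [] \<or> last a \<noteq> last b"
  define S where "S a b = (\<Sum>p\<in>{0..m - 1}. ((-1) ^ p * real (m choose (p + 1))) *\<^sub>R
          (if \<exists>\<delta>. length \<delta> = p \<and> suffix \<delta> a \<and> suffix \<delta> b
           then u (take (length a - p) a) (take (length b - p) b) else 0))" for a b
  \<comment> \<open>Serves both directions: stripping p letters leaves a prefix of \<rho> behind the
    reduced pair, so once \<open>u\<close> is known on prefixes the alternating sum produces the
    next weight.\<close>
  have step: "S (a @ \<rho>) (b @ \<rho>) = bw m (Suc (length \<rho>)) *\<^sub>R u a b"
    if "?red a b" and "\<And>q. q \<le> length \<rho> \<Longrightarrow> u (a @ take q \<rho>) (b @ take q \<rho>) = bw m q *\<^sub>R u a b" for a b \<rho>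
  proof -
    have "S (a @ \<rho>) (b @ \<rho>) = (\<Sum>p\<in>{0..m - 1}. ((-1) ^ p * real (m choose (p + 1)) *
        (if p \<le> length \<rho> then bw m (length \<rho> - p) else 0)) *\<^sub>R u a b)"
      unfolding S_def common_suffix_append_iff[OF that(1)]
      by (intro sum.cong refl) (auto simp: that(2))
    also have "\<dots> = bw m (Suc (length \<rho>)) *\<^sub>R u a b"
      unfolding scaleR_sum_left[symmetric] bw_recurrence[OF m] ..
    finally show ?thesis .
  qed
  show ?thesis
    unfolding S_def[symmetric]
  proof
    assume "\<forall>a\<in>lists A. \<forall>b\<in>lists A. \<forall>j\<in>A. \<forall>l\<in>A.
      u (a @ [j]) (b @ [l]) = (if j = l then S a b else 0)"
    then have L: "u (a @ [j]) (b @ [l]) = (if j = l then S a b else 0)"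
      if "a \<in> lists A" "b \<in> lists A" "j \<in> A" "l \<in> A" for a b j l
      using that by blast
    have base: "u (a @ \<rho>) (b @ \<rho>) = bw m (length \<rho>) *\<^sub>R u a b"
      if "a \<in> lists A" "b \<in> lists A" "?red a b" "\<rho> \<in> lists A" for a b \<rho>
      using that(4)
    \<comment> \<open>The induction is strong because the recurrence looks back at all prefixes of
      \<rho> up to m letters shorter.\<close>
    proof (induction "length \<rho>" arbitrary: \<rho> rule: less_induct)
      case less
      show ?case
      proof (cases \<rho> rule: rev_cases)
        case (snoc \<rho>' j)
        have "u ((a @ \<rho>') @ [j]) ((b @ \<rho>') @ [j]) = S (a @ \<rho>') (b @ \<rho>')"
          using less.prems snoc that by (subst L) auto
        also have "\<dots> = bw m (Suc (length \<rho>')) *\<^sub>R u a b"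
        proof (rule step[OF that(3)])
          fix q assume q: "q \<le> length \<rho>'"
          have "take q \<rho>' \<in> lists A"
            using less.prems snoc by (auto dest: in_set_takeD)
          with q show "u (a @ take q \<rho>') (b @ take q \<rho>') = bw m q *\<^sub>R u a b"
            using less.hyps[of "take q \<rho>'"] snoc by simp
        qed
        finally show ?thesis
          using snoc by simp
      qed simp
    qed
    show ?R
    proof (intro ballI)
      fix a b assume ab: "a \<in> lists A" "b \<in> lists A"
      obtain \<rho> a' b' where d: "a = a' @ \<rho>" "b = b' @ \<rho>" "?red a' b'"
        using longest_common_suffix by blast
      have mem: "a' \<in> lists A" "b' \<in> lists A" "\<rho> \<in> lists A"
        using ab d by auto
      note eq = base[OF mem(1,2) d(3) mem(3)]
      show "u a b =
        (if suffix b a then bw m (length b) *\<^sub>R u (take (length a - length b) a) []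
         else if suffix a b then bw m (length a) *\<^sub>R u [] (take (length b - length a) b)
         else 0)"
      proof (cases "a' = [] \<or> b' = []")
        case True
        then show ?thesis
          using eq d by auto
      next
        case False
        then have "\<not> suffix b' a'" "\<not> suffix a' b'"
          using d(3) by (auto simp: suffix_def)
        moreover have "u a' b' = 0"
        proof -
          \<comment> \<open>Both reduced words are nonempty and end in different letters, so the
            off-diagonal case of the recurrence applies.\<close>
          have "u (butlast a' @ [last a']) (butlast b' @ [last b']) = 0"
            using mem False d(3) by (subst L) (auto dest!: in_set_butlastD simp: in_lists_conv_set)
          then show ?thesis
            using False by simp
        qed
        ultimately show ?thesis
          using eq d by simp
      qed
    qed
  next
    assume "?R"
    then have R: "u a b =
      (if suffix b a then bw m (length b) *\<^sub>R u (take (length a - length b) a) []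
       else if suffix a b then bw m (length a) *\<^sub>R u [] (take (length b - length a) b)
       else 0)" if "a \<in> lists A" "b \<in> lists A" for a b
      using that by blast
    show "\<forall>a\<in>lists A. \<forall>b\<in>lists A. \<forall>j\<in>A. \<forall>l\<in>A.
      u (a @ [j]) (b @ [l]) = (if j = l then S a b else 0)"
    proof (intro ballI)
      fix a b j l assume ab: "a \<in> lists A" "b \<in> lists A" "j \<in> A" "l \<in> A"
      show "u (a @ [j]) (b @ [l]) = (if j = l then S a b else 0)"
      proof (cases "j = l")
        case False
        then have "\<not> suffix (b @ [l]) (a @ [j])" "\<not> suffix (a @ [j]) (b @ [l])"
          by auto
        with R[of "a @ [j]" "b @ [l]"] ab False show ?thesis
          by simp
      next
        case True
        obtain \<rho> a' b' where d: "a = a' @ \<rho>" "b = b' @ \<rho>" "?red a' b'"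
          using longest_common_suffix by blast
        have mem: "a' \<in> lists A" "b' \<in> lists A" "\<rho> \<in> lists A"
          using ab d by auto
        \<comment> \<open>The closed form rewritten relative to the reduced pair; when both reduced
          words are nonempty, both sides are zero.\<close>
        have eq: "u (a' @ \<sigma>) (b' @ \<sigma>) = bw m (length \<sigma>) *\<^sub>R u a' b'" if "\<sigma> \<in> lists A" for \<sigma>
        proof (cases "a' = [] \<or> b' = []")
          case True
          then show ?thesis
            using mem that by (subst R) auto
        next
          case False
          then have n: "\<not> suffix b' a'" "\<not> suffix a' b'"
            using d(3) by (auto simp: suffix_def)
          then show ?thesis
            using R[of "a' @ \<sigma>" "b' @ \<sigma>"] R[OF mem(1,2)] mem(1,2) that by simp
        qed
        have "S (a' @ \<rho>) (b' @ \<rho>) = bw m (Suc (length \<rho>)) *\<^sub>R u a' b'"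
        proof (rule step[OF d(3)])
          fix q assume "q \<le> length \<rho>"
          moreover have "take q \<rho> \<in> lists A"
            using mem(3) by (auto dest: in_set_takeD)
          ultimately show "u (a' @ take q \<rho>) (b' @ take q \<rho>) = bw m q *\<^sub>R u a' b'"
            using eq[of "take q \<rho>"] by simp
        qed
        then show ?thesis
          using eq[of "\<rho> @ [j]"] d mem ab True by simp
      qed
    qed
  qed
qed

section \<open>Inner products, adjoints and bounded operators on subspaces\<close>

section \<open>Operators on spaces of square-summable families\<close>

lemma scaleC_of_real: "complex_of_real r *\<^sub>C x = r *\<^sub>R x"
  by (simp add: scaleR_scaleC)

lemma cinner_scaleR_left: "cinner (r *\<^sub>R x) y = complex_of_real r * cinner x y"
  by (simp add: scaleR_scaleC cinner_scaleC_left)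

lemma cinner_scaleR_right: "cinner x (r *\<^sub>R y) = complex_of_real r * cinner x y"
  by (simp add: scaleR_scaleC cinner_scaleC_right)

lemma cinner_diff_right: "cinner x (y - z) = cinner x y - cinner x z"
  using cinner_add_right[of x "y - z" z] by simp

lemma cinner_diff_left: "cinner (x - y) z = cinner x z - cinner y z"
  using cinner_add_left[of "x - y" y z] by simp

lemma cinner_sum_left: "cinner (\<Sum>j\<in>J. f j) y = (\<Sum>j\<in>J. cinner (f j) y)"
  by (induction J rule: infinite_finite_induct) (auto simp: cinner_add_left)

lemma cinner_self_eq_0_iff: "cinner x x = 0 \<longleftrightarrow> x = 0"
  by (simp add: cinner_self)

lemma cinner_eqI:
  assumes "\<And>y. cinner x y = cinner z y"
  shows "x = z"
proof -
  have "cinner (x - z) (x - z) = 0"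
    by (simp add: cinner_diff_left assms)
  then show ?thesis
    by (simp add: cinner_self_eq_0_iff)
qed

lemma scaleC_scaleR: "c *\<^sub>C (r *\<^sub>R x) = r *\<^sub>R (c *\<^sub>C x)" for x :: "'a::complex_inner"
  by (simp add: scaleR_scaleC scaleC_scaleC mult.commute)

text \<open>The difference of two candidates lies in \<open>S\<close> and is orthogonal to itself,
  hence is zero. Exhibiting one candidate thus computes the adjoint without a representation
  theorem.\<close>

lemma adj_eqI:
  assumes "z \<in> S" "\<And>x. x \<in> S \<Longrightarrow> cinner (A x) y = cinner x z"
    and diff: "\<And>u v. u \<in> S \<Longrightarrow> v \<in> S \<Longrightarrow> u - v \<in> S"
  shows "adj S S' A y = z"
  unfolding adj_def
proof (rule the_equality)
  fix z' assume z': "z' \<in> S \<and> (\<forall>x\<in>S. cinner (A x) y = cinner x z')"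
  then have "cinner (z' - z) (z' - z) = 0"
    using assms diff[of z' z] by (metis cinner_diff_right right_minus_eq)
  then show "z' = z"
    by (simp add: cinner_self_eq_0_iff)
qed (use assms in auto)

lemma bounded_op_0: "bounded_op S S' A \<Longrightarrow> 0 \<in> S \<Longrightarrow> A 0 = 0"
  unfolding bounded_op_def by (metis scaleC_zero_left)

lemma bounded_op_compose:
  assumes A: "bounded_op S S' A" and B: "bounded_op S' S'' B"
  shows "bounded_op S S'' (\<lambda>x. B (A x))"
proof -
  obtain M where M: "\<And>x. x \<in> S \<Longrightarrow> norm (A x) \<le> M * norm x"
    using A unfolding bounded_op_def by blast
  obtain N where N: "\<And>x. x \<in> S' \<Longrightarrow> norm (B x) \<le> N * norm x"
    using B unfolding bounded_op_def by blast
  have S': "A x \<in> S'" if "x \<in> S" for x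
    using A that unfolding bounded_op_def by blast
  have "norm (B (A x)) \<le> (\<bar>N\<bar> * \<bar>M\<bar>) * norm x" if "x \<in> S" for x
  proof -
    have "norm (B (A x)) \<le> N * norm (A x)"
      using N S' that by blast
    also have "\<dots> \<le> \<bar>N\<bar> * norm (A x)"
      by (intro mult_right_mono) auto
    also have "\<dots> \<le> \<bar>N\<bar> * (\<bar>M\<bar> * norm x)"
      using M[OF that] by (intro mult_left_mono order_trans[OF M[OF that]] mult_right_mono) auto
    finally show ?thesis by (simp add: mult.assoc)
  qed
  moreover have "\<forall>x\<in>S. \<forall>y\<in>S. B (A (x + y)) = B (A x) + B (A y)"
    "\<forall>c. \<forall>x\<in>S. B (A (c *\<^sub>C x)) = c *\<^sub>C B (A x)" "(\<lambda>x. B (A x)) ` S \<subseteq> S''"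
    using A B S' unfolding bounded_op_def by auto
  ultimately show ?thesis
    unfolding bounded_op_def by blast
qed

lemma bounded_op_UNIV: "bounded_op S S' A \<Longrightarrow> bounded_op S UNIV A"
  unfolding bounded_op_def by blast

lemma bounded_op_zero: "bounded_op S UNIV (\<lambda>_. 0)"
  unfolding bounded_op_def by (auto intro: exI[of _ 0])

lemma bounded_op_add:
  assumes "bounded_op S UNIV A" "bounded_op S UNIV B"
  shows "bounded_op S UNIV (\<lambda>x. A x + B x)"
proof -
  obtain M where M: "\<And>x. x \<in> S \<Longrightarrow> norm (A x) \<le> M * norm x"
    using assms(1) unfolding bounded_op_def by blast
  obtain N where N: "\<And>x. x \<in> S \<Longrightarrow> norm (B x) \<le> N * norm x"
    using assms(2) unfolding bounded_op_def by blast
  have "norm (A x + B x) \<le> (M + N) * norm x" if "x \<in> S" for x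
    using norm_triangle_ineq[of "A x" "B x"] M[OF that] N[OF that] by (simp add: distrib_right)
  then show ?thesis
    using assms unfolding bounded_op_def by (auto simp: scaleC_add_right)
qed

lemma bounded_op_sum:
  "(\<And>j. j \<in> J \<Longrightarrow> bounded_op S UNIV (A j)) \<Longrightarrow> bounded_op S UNIV (\<lambda>x. \<Sum>j\<in>J. A j x)"
proof (induction J rule: infinite_finite_induct)
  case (insert j J)
  then show ?case
    by (simp add: bounded_op_add)
qed (auto simp: bounded_op_zero)

lemma bounded_op_scaleR:
  assumes "bounded_op S UNIV A"
  shows "bounded_op S UNIV (\<lambda>x. r *\<^sub>R A x)"
proof -
  obtain M where M: "\<And>x. x \<in> S \<Longrightarrow> norm (A x) \<le> M * norm x"
    using assms unfolding bounded_op_def by blast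
  have "norm (r *\<^sub>R A x) \<le> (\<bar>r\<bar> * M) * norm x" if "x \<in> S" for x
    using mult_left_mono[OF M[OF that], of "\<bar>r\<bar>"] by (simp add: mult.assoc)
  then show ?thesis
    using assms unfolding bounded_op_def by (auto simp: scaleC_scaleR scaleR_add_right)
qed

section \<open>Coordinates, truncation and density in square-summable families\<close>

lemma l2_scaleR_nth [simp]: "(r *\<^sub>R f) $$ i = r *\<^sub>R (f $$ i)"
  by (simp add: scaleR_scaleC)

lemma l2_sum_nth: "(\<Sum>j\<in>J. f j) $$ i = (\<Sum>j\<in>J. f j $$ i)"
  by (induction J rule: infinite_finite_induct) auto

lemma l2_norm_square: "(norm f)\<^sup>2 = (\<Sum>\<^sub>\<infinity>i. (norm (f $$ i))\<^sup>2)"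
  unfolding norm_l2_def by (rule real_sqrt_pow2) (simp add: infsum_nonneg)

lemma bounded_op_l2_nth:
  "bounded_op UNIV UNIV (\<lambda>f :: ('i, 'h::complex_inner) l2. f $$ i)"
  unfolding bounded_op_def using norm_l2_nth_le[of _ i] by (auto intro!: exI[of _ 1])

lemma l2_on_zero: "0 \<in> l2_on I"
  and l2_on_add: "f \<in> l2_on I \<Longrightarrow> g \<in> l2_on I \<Longrightarrow> f + g \<in> l2_on I"
  and l2_on_diff: "f \<in> l2_on I \<Longrightarrow> g \<in> l2_on I \<Longrightarrow> f - g \<in> l2_on I"
  by (auto simp: l2_on_def)

lemma l2_on_sum: "(\<And>j. j \<in> J \<Longrightarrow> f j \<in> l2_on I) \<Longrightarrow> (\<Sum>j\<in>J. f j) \<in> l2_on I"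
  by (induction J rule: infinite_finite_induct) (auto simp: l2_on_zero l2_on_add)

lemma bounded_op_sum_arg:
  assumes A: "bounded_op (l2_on I) S' A" and "\<And>j. j \<in> J \<Longrightarrow> f j \<in> l2_on I"
  shows "A (\<Sum>j\<in>J. f j) = (\<Sum>j\<in>J. A (f j))"
proof -
  have A0: "A 0 = 0"
    using A l2_on_zero unfolding bounded_op_def by (metis scaleC_zero_left)
  have add: "A (x + y) = A x + A y" if "x \<in> l2_on I" "y \<in> l2_on I" for x y
    using A that unfolding bounded_op_def by blast
  show ?thesis
    using assms(2)
    by (induction J rule: infinite_finite_induct) (auto simp: A0 add l2_on_sum)
qed

definition single :: "'i \<Rightarrow> 'h \<Rightarrow> ('i, 'h::complex_inner) l2" where
  "single i x = Abs_l2 (\<lambda>j. if j = i then x else 0)"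

lemma single_nth: "single i x $$ j = (if j = i then x else 0)"
  unfolding single_def
  by (rule Abs_l2_nth) (rule finite_nonzero_values_imp_summable_on, simp)

lemma single_in_l2_on: "i \<in> I \<Longrightarrow> single i x \<in> l2_on I"
  by (auto simp: l2_on_def single_nth)

lemma norm_single: "norm (single i x) = norm x"
proof -
  have "(\<Sum>\<^sub>\<infinity>j. (norm (single i x $$ j))\<^sup>2) = (\<Sum>\<^sub>\<infinity>j\<in>{i}. (norm (single i x $$ j))\<^sup>2)"
    by (rule infsum_cong_neutral) (auto simp: single_nth)
  then show ?thesis
    by (simp add: norm_l2_def single_nth)
qed

lemma bounded_op_single: "i \<in> I \<Longrightarrow> bounded_op UNIV (l2_on I) (single i)"
  unfolding bounded_op_def
  by (auto simp: norm_single single_nth intro!: exI[of _ 1] single_in_l2_on l2_eqI)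

text \<open>Restricting to a finite set of coordinates leaves an error whose squared norm is a tail
  of the convergent sum of squares.\<close>

lemma l2_approx_single:
  fixes F :: "('i, 'h::complex_inner) l2"
  assumes F: "F \<in> l2_on I" and e: "e > 0"
  obtains J where "finite J" "J \<subseteq> I" "norm (F - (\<Sum>i\<in>J. single i (F $$ i))) \<le> e"
proof -
  obtain J where J: "finite J" "J \<subseteq> I"
    and d: "dist (\<Sum>i\<in>J. (norm (F $$ i))\<^sup>2) (\<Sum>\<^sub>\<infinity>i\<in>I. (norm (F $$ i))\<^sup>2) \<le> e\<^sup>2"
    using infsum_finite_approximation[OF l2_summable[of F I], of "e\<^sup>2"] e by auto
  let ?D = "F - (\<Sum>i\<in>J. single i (F $$ i))"
  have nth: "?D $$ i = (if i \<in> I - J then F $$ i else 0)" for i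
    using F J by (auto simp: l2_sum_nth single_nth l2_on_def sum.delta)
  have "(norm ?D)\<^sup>2 = (\<Sum>\<^sub>\<infinity>i\<in>I - J. (norm (F $$ i))\<^sup>2)"
    unfolding l2_norm_square by (rule infsum_cong_neutral) (auto simp: nth simp del: l2_nth_simps)
  also have "\<dots> = (\<Sum>\<^sub>\<infinity>i\<in>I. (norm (F $$ i))\<^sup>2) - (\<Sum>\<^sub>\<infinity>i\<in>J. (norm (F $$ i))\<^sup>2)"
    by (rule infsum_Diff) (use J in \<open>auto simp: l2_summable\<close>)
  also have "\<dots> \<le> e\<^sup>2"
    using d J by (simp add: dist_real_def)
  finally show thesis
    using that[OF J] e by (meson power2_le_imp_le less_imp_le)
qed

text \<open>Finite sums of vectors with one nonzero coordinate are dense, and the difference of the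
  two operators is continuous. This reduces operator identities to matrix entries.\<close>

lemma bounded_op_eq_on_l2_on:
  assumes A: "bounded_op (l2_on I) UNIV A" and B: "bounded_op (l2_on I) UNIV B"
    and eq: "\<And>i x. i \<in> I \<Longrightarrow> A (single i x) = B (single i x)" and F: "F \<in> l2_on I"
  shows "A F = B F"
proof -
  define D where "D x = A x + (-1) *\<^sub>R B x" for x
  have D: "bounded_op (l2_on I) UNIV D"
    unfolding D_def by (intro bounded_op_add bounded_op_scaleR A B)
  then obtain M where M: "\<And>x. x \<in> l2_on I \<Longrightarrow> norm (D x) \<le> M * norm x"
    unfolding bounded_op_def by blast
  have "norm (D F) \<le> e" if "e > 0" for e
  proof -
    \<comment> \<open>The tolerance is chosen so that the operator bound turns it into e; adding 1
      keeps the denominator positive.\<close>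
    have "e / (\<bar>M\<bar> + 1) > 0"
      using that by simp
    from l2_approx_single[OF F this] obtain J where J: "J \<subseteq> I"
      and n: "norm (F - (\<Sum>i\<in>J. single i (F $$ i))) \<le> e / (\<bar>M\<bar> + 1)"
      by metis
    let ?G = "\<Sum>i\<in>J. single i (F $$ i)"
    have G: "?G \<in> l2_on I"
      using J by (auto intro!: l2_on_sum single_in_l2_on)
    have "D ?G = (\<Sum>i\<in>J. D (single i (F $$ i)))"
      using J by (intro bounded_op_sum_arg[OF D]) (auto intro!: single_in_l2_on)
    also have "\<dots> = 0"
      using J eq by (intro sum.neutral) (auto simp: D_def)
    finally have "D ((F - ?G) + ?G) = D (F - ?G)"
      using D l2_on_diff[OF F G] G unfolding bounded_op_def by (metis add.right_neutral)
    then have "norm (D F) = norm (D (F - ?G))"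
      by simp
    also have "\<dots> \<le> M * norm (F - ?G)"
      by (rule M[OF l2_on_diff[OF F G]])
    also have "\<dots> \<le> (\<bar>M\<bar> + 1) * norm (F - ?G)"
      by (intro mult_right_mono) auto
    also have "\<dots> \<le> (\<bar>M\<bar> + 1) * (e / (\<bar>M\<bar> + 1))"
      by (intro mult_left_mono n) auto
    finally show ?thesis
      by simp
  qed
  then have "norm (D F) \<le> 0"
    using field_le_epsilon[of "norm (D F)" 0] by simp
  then show ?thesis
    by (simp add: D_def)
qed

text \<open>A weighted composition operator. All shifts below, their adjoints and the diagonal
  operators have this form, so boundedness and adjoints are settled once. The weights are real, so
  adjoints involve no conjugation.\<close>

definition wcomp ::
  "'i set \<Rightarrow> ('i \<Rightarrow> 'j) \<Rightarrow> ('i \<Rightarrow> real) \<Rightarrow> ('j, 'h::complex_inner) l2 \<Rightarrow> ('i, 'h) l2" where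
  "wcomp S \<phi> c F = Abs_l2 (\<lambda>i. if i \<in> S then c i *\<^sub>R (F $$ \<phi> i) else 0)"

context
  fixes S :: "'i set" and \<phi> :: "'i \<Rightarrow> 'j" and c :: "'i \<Rightarrow> real" and C :: real
  assumes inj: "inj_on \<phi> S" and c: "\<And>i. i \<in> S \<Longrightarrow> \<bar>c i\<bar> \<le> C"
begin

text \<open>By injectivity each coordinate of \<open>F\<close> is used at most once, with a factor
  of modulus at most \<open>C\<close>.\<close>

lemma wcomp_summable:
  fixes F :: "('j, 'h::complex_inner) l2"
  shows "(\<lambda>i. (norm (if i \<in> S then c i *\<^sub>R (F $$ \<phi> i) else 0))\<^sup>2) summable_on UNIV" (is "?f summable_on _")
    and "(\<Sum>\<^sub>\<infinity>i. (norm (if i \<in> S then c i *\<^sub>R (F $$ \<phi> i) else 0))\<^sup>2) \<le> C\<^sup>2 * (norm F)\<^sup>2"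
proof -
  have s: "(\<lambda>i. (norm (F $$ \<phi> i))\<^sup>2) summable_on S"
    using l2_summable[of F "\<phi> ` S"] by (subst (asm) summable_on_reindex[OF inj]) (simp add: o_def)
  have le: "?f i \<le> C\<^sup>2 * (norm (F $$ \<phi> i))\<^sup>2" if "i \<in> S" for i
    using that power_mono[OF c[OF that] abs_ge_zero, of 2]
    by (auto simp: power_mult_distrib intro!: mult_right_mono)
  have "?f summable_on S"
    by (rule summable_on_comparison_test[OF summable_on_cmult_right[OF s, of "C\<^sup>2"]]) (use le in auto)
  then show summ: "?f summable_on UNIV"
    by (subst (asm) summable_on_cong_neutral) auto
  have "infsum ?f UNIV = infsum ?f S"
    by (rule infsum_cong_neutral) auto
  also have "\<dots> \<le> (\<Sum>\<^sub>\<infinity>i\<in>S. C\<^sup>2 * (norm (F $$ \<phi> i))\<^sup>2)"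
    by (rule infsum_mono[OF \<open>?f summable_on S\<close> summable_on_cmult_right[OF s]]) (rule le)
  also have "\<dots> = C\<^sup>2 * (\<Sum>\<^sub>\<infinity>i\<in>S. (norm (F $$ \<phi> i))\<^sup>2)"
    by (rule infsum_cmult_right')
  also have "(\<Sum>\<^sub>\<infinity>i\<in>S. (norm (F $$ \<phi> i))\<^sup>2) = (\<Sum>\<^sub>\<infinity>j\<in>\<phi> ` S. (norm (F $$ j))\<^sup>2)"
    by (subst infsum_reindex[OF inj]) (simp add: o_def)
  also have "\<dots> \<le> (norm F)\<^sup>2"
    unfolding l2_norm_square by (rule infsum_mono_neutral) (auto simp: l2_summable)
  finally show "infsum ?f UNIV \<le> C\<^sup>2 * (norm F)\<^sup>2"
    by (simp add: mult_left_mono)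
qed

lemma wcomp_nth: "wcomp S \<phi> c F $$ i = (if i \<in> S then c i *\<^sub>R (F $$ \<phi> i) else 0)"
  for F :: "('j, 'h::complex_inner) l2"
  unfolding wcomp_def by (rule Abs_l2_nth[OF wcomp_summable(1)])

lemma bounded_op_wcomp: "bounded_op UNIV (l2_on S) (wcomp S \<phi> c :: ('j, 'h::complex_inner) l2 \<Rightarrow> _)"
proof -
  \<comment> \<open>The absolute value covers an empty \<open>S\<close>, for which \<open>C\<close>
    may be negative.\<close>
  have "norm (wcomp S \<phi> c F) \<le> \<bar>C\<bar> * norm F" for F :: "('j, 'h) l2"
  proof (rule power2_le_imp_le)
    show "(norm (wcomp S \<phi> c F))\<^sup>2 \<le> (\<bar>C\<bar> * norm F)\<^sup>2"
      unfolding l2_norm_square[of "wcomp S \<phi> c F"] wcomp_nth power_mult_distrib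
      using wcomp_summable(2)[of F] by simp
  qed simp
  then show ?thesis
    unfolding bounded_op_def
    by (auto simp: l2_on_def wcomp_nth scaleR_add_right scaleC_scaleR intro!: l2_eqI)
qed

end

text \<open>Reindexing the inner product along the bijection \<phi> shows that the adjoint composes
  with the inverse map and carries the same weights.\<close>

lemma cinner_wcomp:
  fixes F :: "('j, 'h::complex_inner) l2"
  assumes bij: "bij_betw \<phi> S S'" and c: "\<And>i. i \<in> S \<Longrightarrow> \<bar>c i\<bar> \<le> C"
    and inv: "\<And>i. i \<in> S \<Longrightarrow> \<psi> (\<phi> i) = i" and d: "\<And>i. i \<in> S \<Longrightarrow> d (\<phi> i) = c i"
  shows "cinner (wcomp S \<phi> c F) G = cinner F (wcomp S' \<psi> d G)"
proof -
  have inj: "inj_on \<phi> S" and S': "S' = \<phi> ` S"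
    using bij by (auto simp: bij_betw_def)
  have inj': "inj_on \<psi> S'"
    unfolding S' by (rule inj_onI) (auto simp: inv)
  have d': "\<bar>d j\<bar> \<le> C" if "j \<in> S'" for j
    using that by (auto simp: S' d c)
  have "cinner (wcomp S \<phi> c F) G = (\<Sum>\<^sub>\<infinity>i\<in>S. of_real (c i) * cinner (F $$ \<phi> i) (G $$ i))"
    unfolding cinner_l2_def
    by (rule infsum_cong_neutral) (auto simp: wcomp_nth[OF inj c] cinner_scaleR_left)
  also have "\<dots> = (\<Sum>\<^sub>\<infinity>i\<in>S. of_real (d (\<phi> i)) * cinner (F $$ \<phi> i) (G $$ \<psi> (\<phi> i)))"
    by (rule infsum_cong) (simp add: inv d)
  also have "\<dots> = (\<Sum>\<^sub>\<infinity>j\<in>S'. of_real (d j) * cinner (F $$ j) (G $$ \<psi> j))"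
    by (rule infsum_reindex_bij_betw[OF bij])
  also have "\<dots> = cinner F (wcomp S' \<psi> d G)"
    unfolding cinner_l2_def
    by (rule infsum_cong_neutral) (auto simp: wcomp_nth[OF inj' d'] cinner_scaleR_right)
  finally show ?thesis .
qed

section \<open>Right shifts in one coordinate, their adjoints and their composition\<close>

section \<open>Weighted shifts in one coordinate\<close>

definition coord_drop :: "nat \<Rightarrow> nat \<Rightarrow> (nat \<Rightarrow> 'a list) \<Rightarrow> nat \<Rightarrow> 'a list" where
  "coord_drop i p \<alpha> = \<alpha>(i := take (length (\<alpha> i) - p) (\<alpha> i))"

definition coord_append :: "nat \<Rightarrow> 'a list \<Rightarrow> (nat \<Rightarrow> 'a list) \<Rightarrow> nat \<Rightarrow> 'a list" where
  "coord_append i \<delta> \<alpha> = \<alpha>(i := \<alpha> i @ \<delta>)"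

lemma coord_append_same [simp]: "coord_append i \<delta> \<alpha> i = \<alpha> i @ \<delta>"
  and coord_drop_same [simp]: "coord_drop i p \<alpha> i = take (length (\<alpha> i) - p) (\<alpha> i)"
  by (simp_all add: coord_append_def coord_drop_def)

lemma coord_drop_append [simp]: "coord_drop i (length \<delta>) (coord_append i \<delta> \<alpha>) = \<alpha>"
  by (simp add: coord_drop_def coord_append_def)

lemma coord_append_drop: "suffix \<delta> (\<alpha> i) \<Longrightarrow> coord_append i \<delta> (coord_drop i (length \<delta>) \<alpha>) = \<alpha>"
  by (auto simp: coord_drop_def coord_append_def suffix_def)

text \<open>Truncated subtraction makes this true also when the word has fewer than
  \<open>p + q\<close> letters.\<close>

lemma coord_drop_drop: "coord_drop i p (coord_drop i q \<alpha>) = coord_drop i (p + q) \<alpha>"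
  by (simp add: coord_drop_def min.absorb1 min.absorb2 add.commute)

text \<open>On basis vectors this appends \<delta> to the i-th word, with a factor depending on the
  length of that word before appending; hence the subtraction of
  \<open>length \<delta>\<close>.\<close>

definition shift_op ::
  "nat \<Rightarrow> (nat \<Rightarrow> nat) \<Rightarrow> nat \<Rightarrow> (nat \<Rightarrow> real) \<Rightarrow> nat list \<Rightarrow>
    (nat \<Rightarrow> nat list, 'k::complex_inner) l2 \<Rightarrow> (nat \<Rightarrow> nat list, 'k) l2" where
  "shift_op k n i c \<delta> = wcomp {\<alpha> \<in> multi_sg k n. suffix \<delta> (\<alpha> i)} (coord_drop i (length \<delta>))
     (\<lambda>\<alpha>. c (length (\<alpha> i) - length \<delta>))"

text \<open>The adjoint of \<open>shift_op\<close> for words over the i-th alphabet: on basis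
  vectors it removes the suffix \<delta> and annihilates words without it.\<close>

definition coshift_op ::
  "nat \<Rightarrow> (nat \<Rightarrow> nat) \<Rightarrow> nat \<Rightarrow> (nat \<Rightarrow> real) \<Rightarrow> nat list \<Rightarrow>
    (nat \<Rightarrow> nat list, 'k::complex_inner) l2 \<Rightarrow> (nat \<Rightarrow> nat list, 'k) l2" where
  "coshift_op k n i c \<delta> = wcomp (multi_sg k n) (coord_append i \<delta>) (\<lambda>\<alpha>. c (length (\<alpha> i)))"

lemma free_sg_append: "a @ b \<in> free_sg N \<longleftrightarrow> a \<in> free_sg N \<and> b \<in> free_sg N"
  by (auto simp: free_sg_def)

lemma multi_sg_coord: "\<alpha> \<in> multi_sg k n \<Longrightarrow> i \<in> {1..k} \<Longrightarrow> \<alpha> i \<in> free_sg (n i)"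
  by (auto simp: multi_sg_def)

lemma coord_drop_multi_sg: "\<alpha> \<in> multi_sg k n \<Longrightarrow> i \<in> {1..k} \<Longrightarrow> coord_drop i p \<alpha> \<in> multi_sg k n"
  using multi_sg_coord[of \<alpha> k n i]
  by (auto simp: coord_drop_def multi_sg_upd free_sg_def dest: in_set_takeD)

lemma coord_append_multi_sg:
  "\<alpha> \<in> multi_sg k n \<Longrightarrow> i \<in> {1..k} \<Longrightarrow> \<delta> \<in> free_sg (n i) \<Longrightarrow> coord_append i \<delta> \<alpha> \<in> multi_sg k n"
  using multi_sg_coord[of \<alpha> k n i] by (auto simp: coord_append_def multi_sg_upd free_sg_append)

lemma inj_on_coord_drop: "inj_on (coord_drop i (length \<delta>)) {\<alpha> \<in> A. suffix \<delta> (\<alpha> i)}"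
  by (rule inj_onI) (metis (mono_tags, lifting) coord_append_drop mem_Collect_eq)

lemma inj_on_coord_append: "inj_on (coord_append i \<delta>) A"
  by (rule inj_onI) (metis coord_drop_append)

context
  fixes k i :: nat and n :: "nat \<Rightarrow> nat" and c :: "nat \<Rightarrow> real"
  assumes c: "bounded (range c)"
begin

lemma shift_op_nth:
  "shift_op k n i c \<delta> F $$ \<alpha> = (if \<alpha> \<in> multi_sg k n \<and> suffix \<delta> (\<alpha> i)
     then c (length (\<alpha> i) - length \<delta>) *\<^sub>R (F $$ coord_drop i (length \<delta>) \<alpha>) else 0)"
proof -
  obtain C where "\<And>q. \<bar>c q\<bar> \<le> C"
    using c by (auto simp: bounded_iff)
  then show ?thesis
    unfolding shift_op_def by (subst wcomp_nth[OF inj_on_coord_drop]) auto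
qed

lemma coshift_op_nth:
  "coshift_op k n i c \<delta> F $$ \<alpha> = (if \<alpha> \<in> multi_sg k n
     then c (length (\<alpha> i)) *\<^sub>R (F $$ coord_append i \<delta> \<alpha>) else 0)"
proof -
  obtain C where "\<And>q. \<bar>c q\<bar> \<le> C"
    using c by (auto simp: bounded_iff)
  then show ?thesis
    unfolding coshift_op_def by (subst wcomp_nth[OF inj_on_coord_append]) auto
qed

lemma bounded_op_shift_op: "bounded_op S (tensor_space k n) (shift_op k n i c \<delta>)"
proof -
  obtain C where "\<And>q. \<bar>c q\<bar> \<le> C"
    using c by (auto simp: bounded_iff)
  then have "bounded_op UNIV (l2_on {\<alpha> \<in> multi_sg k n. suffix \<delta> (\<alpha> i)}) (shift_op k n i c \<delta>)"
    unfolding shift_op_def by (intro bounded_op_wcomp[OF inj_on_coord_drop])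
  then show ?thesis
    unfolding bounded_op_def tensor_space_def l2_on_def by blast
qed

lemma bounded_op_coshift_op: "bounded_op S (tensor_space k n) (coshift_op k n i c \<delta>)"
proof -
  obtain C where "\<And>q. \<bar>c q\<bar> \<le> C"
    using c by (auto simp: bounded_iff)
  then have "bounded_op UNIV (l2_on (multi_sg k n)) (coshift_op k n i c \<delta>)"
    unfolding coshift_op_def by (intro bounded_op_wcomp[OF inj_on_coord_append])
  then show ?thesis
    unfolding bounded_op_def tensor_space_def by blast
qed

lemma shift_op_in: "shift_op k n i c \<delta> F \<in> tensor_space k n"
  and coshift_op_in: "coshift_op k n i c \<delta> F \<in> tensor_space k n"
  by (auto simp: tensor_space_def l2_on_def shift_op_nth coshift_op_nth)

text \<open>Dropping \<delta> is a bijection from the words ending in \<delta> onto all words, with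
  appending as its inverse. Surjectivity uses that \<delta> is a word over the i-th
  alphabet.\<close>

lemma cinner_shift_op:
  assumes "i \<in> {1..k}" "\<delta> \<in> free_sg (n i)"
  shows "cinner (shift_op k n i c \<delta> F) G = cinner F (coshift_op k n i c \<delta> G)"
proof -
  obtain C where C: "\<And>q. \<bar>c q\<bar> \<le> C"
    using c by (auto simp: bounded_iff)
  have "bij_betw (coord_drop i (length \<delta>)) {\<alpha> \<in> multi_sg k n. suffix \<delta> (\<alpha> i)} (multi_sg k n)"
    unfolding bij_betw_def
  proof (intro conjI inj_on_coord_drop subset_antisym subsetI)
    fix \<alpha> assume "\<alpha> \<in> multi_sg k n"
    then have "\<alpha> = coord_drop i (length \<delta>) (coord_append i \<delta> \<alpha>)" "coord_append i \<delta> \<alpha> \<in> multi_sg k n" "suffix \<delta> (coord_append i \<delta> \<alpha> i)"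
      using assms by (auto intro: coord_append_multi_sg suffixI)
    then show "\<alpha> \<in> coord_drop i (length \<delta>) ` {\<alpha> \<in> multi_sg k n. suffix \<delta> (\<alpha> i)}"
      by blast
  qed (use assms coord_drop_multi_sg in auto)
  then show ?thesis
    unfolding shift_op_def coshift_op_def
    by (rule cinner_wcomp) (use C in \<open>auto simp: coord_append_drop min.absorb2\<close>)
qed

lemma shift_op_single:
  assumes "i \<in> {1..k}" "\<delta> \<in> free_sg (n i)" "\<gamma> \<in> multi_sg k n"
  shows "shift_op k n i c \<delta> (single \<gamma> x) = c (length (\<gamma> i)) *\<^sub>R single (coord_append i \<delta> \<gamma>) x"
  using coord_append_multi_sg[OF assms(3,1,2)]
  by (intro l2_eqI) (auto simp: shift_op_nth single_nth coord_append_drop intro: suffixI)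

lemma coshift_op_single:
  assumes "i \<in> {1..k}" "\<delta> \<in> free_sg (n i)" "\<gamma> \<in> multi_sg k n"
  shows "coshift_op k n i c \<delta> (single \<gamma> x) = (if suffix \<delta> (\<gamma> i)
    then c (length (\<gamma> i) - length \<delta>) *\<^sub>R single (coord_drop i (length \<delta>) \<gamma>) x else 0)"
proof (rule l2_eqI)
  fix \<alpha>
  have "coord_append i \<delta> \<alpha> = \<gamma> \<longleftrightarrow> suffix \<delta> (\<gamma> i) \<and> \<alpha> = coord_drop i (length \<delta>) \<gamma>"
    by (auto simp: coord_append_drop intro: suffixI)
  then show "coshift_op k n i c \<delta> (single \<gamma> x) $$ \<alpha> = (if suffix \<delta> (\<gamma> i)
    then c (length (\<gamma> i) - length \<delta>) *\<^sub>R single (coord_drop i (length \<delta>) \<gamma>) x else 0) $$ \<alpha>"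
    using coord_drop_multi_sg[OF assms(3,1)] by (auto simp: coshift_op_nth single_nth min.absorb2)
qed

end

text \<open>The inner operator appends \<epsilon> first, so \<delta> lands to its right and the
  outer weight sees a word longer by \<open>length \<epsilon>\<close>.\<close>

lemma shift_op_compose:
  assumes c: "bounded (range c)" and d: "bounded (range d)" and i: "i \<in> {1..k}"
  shows "shift_op k n i c \<delta> (shift_op k n i d \<epsilon> F)
    = shift_op k n i (\<lambda>q. c (q + length \<epsilon>) * d q) (\<epsilon> @ \<delta>) F"
proof -
  obtain C D where C: "\<And>q. \<bar>c q\<bar> \<le> C" and D: "\<And>q. \<bar>d q\<bar> \<le> D"
    using c d by (auto simp: bounded_iff)
  have "\<bar>c (q + length \<epsilon>) * d q\<bar> \<le> C * D" for q
    unfolding abs_mult by (intro mult_mono C D order_trans[OF abs_ge_zero C]) auto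
  then have cd: "bounded (range (\<lambda>q. c (q + length \<epsilon>) * d q))"
    by (auto simp: bounded_iff)
  have "suffix (\<epsilon> @ \<delta>) a \<longleftrightarrow> suffix \<delta> a \<and> suffix \<epsilon> (take (length a - length \<delta>) a)" for a :: "nat list"
    by (auto simp: suffix_def)
  then show ?thesis
    using i by (intro l2_eqI)
      (auto simp: shift_op_nth[OF c] shift_op_nth[OF d] shift_op_nth[OF cd] coord_drop_multi_sg coord_drop_drop
        suffix_def add.commute)
qed

lemma shift_op_Nil: "F \<in> tensor_space k n \<Longrightarrow> shift_op k n i (\<lambda>_. 1) [] F = F"
  by (intro l2_eqI) (auto simp: shift_op_nth coord_drop_def tensor_space_def l2_on_def)

section \<open>Telescoping weights of products of shifts, and the reciprocal weights of the Cauchy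
  dual\<close>

section \<open>The weights of the operators\<close>

text \<open>The telescoped product of p consecutive values of \<open>D_coeff\<close>, starting at
  word length q.\<close>

definition shift_weight :: "nat \<Rightarrow> nat \<Rightarrow> nat \<Rightarrow> real" where
  "shift_weight m p q = sqrt (bw m q / bw m (q + p))"

text \<open>The reciprocal of the one-step shift weight r, since passing to the Cauchy dual replaces
  r by r / r^2.\<close>

definition dual_weight :: "nat \<Rightarrow> nat \<Rightarrow> real" where
  "dual_weight m q = sqrt (bw m (Suc q) / bw m q)"

lemma shift_weight_0: "m \<ge> 1 \<Longrightarrow> shift_weight m 0 q = 1"
  using bw_pos[of m q] by (simp add: shift_weight_def)

lemma shift_weight_pos: "m \<ge> 1 \<Longrightarrow> shift_weight m p q > 0"
  using bw_pos[of m] by (simp add: shift_weight_def)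

lemma dual_weight_pos: "m \<ge> 1 \<Longrightarrow> dual_weight m q > 0"
  using bw_pos[of m] by (simp add: dual_weight_def)

lemma shift_weight_1: "shift_weight m 1 q * dual_weight m q = 1" if "m \<ge> 1"
  using bw_pos[OF that, of q] bw_pos[OF that, of "Suc q"]
  by (simp add: shift_weight_def dual_weight_def flip: real_sqrt_mult)

lemma shift_weight_Suc: "shift_weight m 1 (q + p) * shift_weight m p q = shift_weight m (Suc p) q" if "m \<ge> 1"
  using bw_pos[OF that, of q] bw_pos[OF that, of "q + p"] bw_pos[OF that, of "Suc (q + p)"]
  by (simp add: shift_weight_def flip: real_sqrt_mult)

lemma bw_Suc_ge: "m \<ge> 1 \<Longrightarrow> bw m q \<le> bw m (Suc q)"
proof -
  assume m: "m \<ge> 1"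
  have "(real q + 1) * bw m q \<le> (real q + real m) * bw m q"
    using m bw_pos[OF m, of q] by (intro mult_right_mono) auto
  then show ?thesis
    unfolding bw_Suc[OF m, symmetric] by (simp add: mult_le_cancel_left)
qed

lemma bounded_shift_weight: "m \<ge> 1 \<Longrightarrow> bounded (range (shift_weight m p))"
proof -
  assume m: "m \<ge> 1"
  have "bw m q \<le> bw m (q + p)" for q
    using lift_Suc_mono_le[of "bw m" q "q + p"] bw_Suc_ge[OF m] by simp
  then have "\<bar>shift_weight m p q\<bar> \<le> 1" for q
    using bw_pos[OF m, of q] bw_pos[OF m, of "q + p"] by (auto simp: shift_weight_def)
  then show ?thesis
    by (auto simp: bounded_iff)
qed

text \<open>The quotient (q + m) / (q + 1) of consecutive weights never exceeds m, so the dual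
  weights are at most the square root of m.\<close>

lemma bounded_dual_weight: "m \<ge> 1 \<Longrightarrow> bounded (range (dual_weight m))"
proof -
  assume m: "m \<ge> 1"
  have "bw m (Suc q) / bw m q \<le> real m" for q
  proof -
    have "(real q + 1) * bw m (Suc q) \<le> (real q + 1) * (real m * bw m q)"
    proof -
      have "real q * 1 \<le> real q * real m"
        using m by (intro mult_left_mono) auto
      then have "(real q + real m) * bw m q \<le> ((real q + 1) * real m) * bw m q"
        using bw_pos[OF m, of q] by (intro mult_right_mono) (auto simp: algebra_simps)
      then show ?thesis
        unfolding bw_Suc[OF m] by (simp add: mult.assoc)
    qed
    then show ?thesis
      using bw_pos[OF m, of q] by (subst (asm) mult_le_cancel_left_pos) (simp_all add: pos_divide_le_eq)
  qed
  then have "\<bar>dual_weight m q\<bar> \<le> sqrt (real m)" for q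
    using dual_weight_pos[OF m, of q] by (simp add: dual_weight_def)
  then show ?thesis
    by (auto simp: bounded_iff)
qed

lemma Lam_eq_shift_op:
  assumes m: "m i \<ge> 1" and i: "i \<in> {1..k}"
  shows "Lam k m n i j = shift_op k n i (shift_weight (m i) 1) [j]"
proof (intro ext l2_eqI)
  fix F :: "(nat \<Rightarrow> nat list, 'a) l2" and \<alpha>
  have "suffix [j] (\<alpha> i) \<longleftrightarrow> \<alpha> i \<noteq> [] \<and> last (\<alpha> i) = j"
    by (cases "\<alpha> i" rule: rev_cases) auto
  moreover have "D_coeff (m i) a *\<^sub>C x = shift_weight (m i) 1 (length a) *\<^sub>R x" for a and x :: 'a
    unfolding D_coeff_def scaleC_of_real shift_weight_def
    using bw_ratio[OF m, of "length a"] by simp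
  ultimately show "Lam k m n i j F $$ \<alpha> = shift_op k n i (shift_weight (m i) 1) [j] F $$ \<alpha>"
    by (simp add: Lam_nth[where m = m, OF m i] shift_op_nth[OF bounded_shift_weight[OF m]] coord_drop_def
        butlast_conv_take)
qed

text \<open>The leftmost factor acts last and its letter ends up rightmost, so the appended word is
  the reversal of \<beta>; the one-step weights telescope.\<close>

lemma Lam_word_eq_shift_op:
  assumes m: "m i \<ge> 1" and i: "i \<in> {1..k}" and F: "F \<in> tensor_space k n"
  shows "Lam_word k m n i \<beta> F = shift_op k n i (shift_weight (m i) (length \<beta>)) (rev \<beta>) F"
proof (induction \<beta>)
  case Nil
  \<comment> \<open>The empty product is the identity, whereas \<open>shift_op\<close> vanishes off
    \<open>multi_sg k n\<close>; they agree because \<open>F\<close> lies in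
    \<open>tensor_space k n\<close>.\<close>
  have "shift_weight (m i) 0 = (\<lambda>_. 1)"
    using shift_weight_0[OF m] by auto
  then show ?case
    using F by (simp add: Lam_word_def shift_op_Nil)
next
  case (Cons j \<beta>)
  have "Lam_word k m n i (j # \<beta>) F = Lam k m n i j (Lam_word k m n i \<beta> F)"
    by (simp add: Lam_word_def)
  also have "\<dots> = shift_op k n i (\<lambda>q. shift_weight (m i) 1 (q + length (rev \<beta>)) * shift_weight (m i) (length \<beta>) q) (rev \<beta> @ [j]) F"
    unfolding Cons.IH Lam_eq_shift_op[where m = m, OF m i] by (rule shift_op_compose) (intro bounded_shift_weight m i)+
  finally show ?case
    by (simp add: shift_weight_Suc[OF m, unfolded One_nat_def])
qed

section \<open>Row operators, the Cauchy dual, and the Brown-Halmos identity block by block\<close>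

section \<open>Matrix entries of the Brown-Halmos condition\<close>

definition tuple :: "nat \<Rightarrow> (nat \<Rightarrow> 'h::complex_inner) \<Rightarrow> (nat, 'h) l2" where
  "tuple N f = Abs_l2 (\<lambda>j. if j \<in> {1..N} then f j else 0)"

lemma tuple_nth: "tuple N f $$ j = (if j \<in> {1..N} then f j else 0)"
  unfolding tuple_def
  by (rule Abs_l2_nth, rule finite_nonzero_values_imp_summable_on)
    (auto intro: finite_subset[of _ "{1..N}"])

lemma tuple_in_copies: "(\<And>j. j \<in> {1..N} \<Longrightarrow> f j \<in> S) \<Longrightarrow> tuple N f \<in> copies N S"
  by (auto simp: copies_def l2_on_def tuple_nth)

lemma tuple_eq_iff: "tuple N f = tuple N g \<longleftrightarrow> (\<forall>j\<in>{1..N}. f j = g j)"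
proof
  assume "tuple N f = tuple N g"
  then show "\<forall>j\<in>{1..N}. f j = g j"
    by (metis tuple_nth)
qed (auto intro!: l2_eqI simp: tuple_nth)

lemma diag_eq_tuple: "diag N A X = tuple N (\<lambda>j. A (X $$ j))"
  by (simp add: diag_def tuple_def)

lemma cinner_tuple: "cinner X (tuple N f) = (\<Sum>j\<in>{1..N}. cinner (X $$ j) (f j))"
proof -
  have "cinner X (tuple N f) = (\<Sum>\<^sub>\<infinity>j\<in>{1..N}. cinner (X $$ j) (f j))"
    unfolding cinner_l2_def by (rule infsum_cong_neutral) (auto simp: tuple_nth)
  then show ?thesis by simp
qed

lemma copies_tensor_diff:
  "X \<in> copies N (tensor_space k n) \<Longrightarrow> Y \<in> copies N (tensor_space k n) \<Longrightarrow> X - Y \<in> copies N (tensor_space k n)"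
  by (auto simp: copies_def tensor_space_def l2_on_def)

lemma copies_nth_in: "X \<in> copies N (tensor_space k n) \<Longrightarrow> X $$ j \<in> tensor_space k n"
  by (cases "j \<in> {1..N}") (auto simp: copies_def tensor_space_def l2_on_def)

text \<open>The adjoint of a row is the column of adjoints. The formula for \<open>A\<close> is
  required only on the direct sum because the Cauchy dual, built from \<open>inv_into\<close>, is
  known only there.\<close>

lemma adj_row:
  assumes i: "i \<in> {1..k}" and c: "bounded (range c)"
    and A: "\<And>X. X \<in> copies (n i) (tensor_space k n) \<Longrightarrow> A X = (\<Sum>l\<in>{1..n i}. shift_op k n i c [l] (X $$ l))"
  shows "adj (copies (n i) (tensor_space k n)) S' A G = tuple (n i) (\<lambda>j. coshift_op k n i c [j] G)"
proof (rule adj_eqI[OF _ _ copies_tensor_diff])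
  show "tuple (n i) (\<lambda>j. coshift_op k n i c [j] G) \<in> copies (n i) (tensor_space k n)"
    by (intro tuple_in_copies coshift_op_in c)
  fix X :: "(nat, (nat \<Rightarrow> nat list, 'a) l2) l2"
  assume "X \<in> copies (n i) (tensor_space k n)"
  from A[OF this] show "cinner (A X) G = cinner X (tuple (n i) (\<lambda>j. coshift_op k n i c [j] G))"
    using i by (auto simp: cinner_sum_left cinner_tuple cinner_shift_op[OF c] free_sg_def intro!: sum.cong)
qed

text \<open>Shifts by different letters have orthogonal ranges, so the product of the adjoint row
  with the row is diagonal with positive entries r^2. Its inverse multiplies by v^2, where v = 1 /
  r, and the row followed by r v^2 = v remains.\<close>

lemma cauchy_dual_Lam_row:
  fixes X :: "(nat, (nat \<Rightarrow> nat list, 'k::complex_inner) l2) l2"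
  assumes m: "m i \<ge> 1" and i: "i \<in> {1..k}" and X: "X \<in> copies (n i) (tensor_space k n)"
  shows "cauchy_dual (copies (n i) (tensor_space k n)) (tensor_space k n) (Lam_row k m n i) X
    = (\<Sum>l\<in>{1..n i}. shift_op k n i (dual_weight (m i)) [l] (X $$ l))"
proof -
  let ?HN = "copies (n i) (tensor_space k n) :: (nat, (nat \<Rightarrow> nat list, 'k) l2) l2 set"
  let ?L = "Lam_row k m n i :: _ \<Rightarrow> (nat \<Rightarrow> nat list, 'k) l2"
  let ?r = "shift_weight (m i) 1" and ?v = "dual_weight (m i)"
  have br: "bounded (range ?r)" and bv: "bounded (range ?v)"
    by (intro bounded_shift_weight bounded_dual_weight m)+
  obtain V where V: "\<And>q. \<bar>?v q\<bar> \<le> V"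
    using bv by (auto simp: bounded_iff)
  have "\<bar>(?v q)\<^sup>2\<bar> \<le> V\<^sup>2" for q
    using power_mono[OF V[of q] abs_ge_zero, of 2] by simp
  then have bvv: "bounded (range (\<lambda>q. (?v q)\<^sup>2))"
    by (auto simp: bounded_iff)
  have L: "?L X = (\<Sum>l\<in>{1..n i}. shift_op k n i ?r [l] (X $$ l))" for X
    by (simp add: Lam_row_def Lam_eq_shift_op[where m = m, OF m i])
  let ?f = "adj ?HN (tensor_space k n) ?L \<circ> ?L"
  have f: "?f X $$ j $$ \<alpha> = (?r (length (\<alpha> i)))\<^sup>2 *\<^sub>R (X $$ j $$ \<alpha>)" if "X \<in> ?HN" for X j \<alpha>
  proof (cases "j \<in> {1..n i} \<and> \<alpha> \<in> multi_sg k n")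
    case True
    then have app: "coord_append i [j] \<alpha> \<in> multi_sg k n"
      using i by (intro coord_append_multi_sg) (auto simp: free_sg_def)
    have "?f X $$ j $$ \<alpha> = ?r (length (\<alpha> i)) *\<^sub>R (?L X $$ coord_append i [j] \<alpha>)"
      unfolding o_def adj_row[OF i br L] using True by (simp add: tuple_nth coshift_op_nth[OF br] del: One_nat_def)
    \<comment> \<open>Only the summand \<open>l = j\<close> survives, because the word read here
      ends in \<open>j\<close>.\<close>
    also have "?L X $$ coord_append i [j] \<alpha>
        = (\<Sum>l\<in>{1..n i}. if l = j then ?r (length (\<alpha> i)) *\<^sub>R (X $$ j $$ \<alpha>) else 0)"
      unfolding L l2_sum_nth
      by (rule sum.cong) (use app coord_drop_append[of i "[j]" \<alpha>] in \<open>auto simp: shift_op_nth[OF br] simp del: One_nat_def\<close>)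
    finally show ?thesis
      using True by (simp add: power2_eq_square)
  next
    case False
    then show ?thesis
      using copies_nth_in[OF that, of j] that unfolding o_def adj_row[OF i br L]
      by (auto simp: tuple_nth coshift_op_nth[OF br] tensor_space_def l2_on_def copies_def simp del: One_nat_def)
  qed
  \<comment> \<open>Candidate for the preimage of \<open>X\<close>: a shift by the empty word is a
    diagonal operator, here the inverse of multiplication by r^2.\<close>
  define Y where "Y = tuple (n i) (\<lambda>j. shift_op k n i (\<lambda>q. (?v q)\<^sup>2) [] (X $$ j))"
  have Y: "Y \<in> ?HN"
    unfolding Y_def by (intro tuple_in_copies shift_op_in bvv)
  have rv: "?r q * ?v q = 1" for q
    by (rule shift_weight_1[OF m])
  have inj: "inj_on ?f ?HN"
  proof (rule inj_onI)
    fix X Z assume XZ: "X \<in> ?HN" "Z \<in> ?HN" "?f X = ?f Z"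
    have "X $$ j $$ \<alpha> = Z $$ j $$ \<alpha>" for j \<alpha>
      using f[OF XZ(1), of j \<alpha>] f[OF XZ(2), of j \<alpha>] XZ(3) shift_weight_pos[OF m, of 1 "length (\<alpha> i)"] by simp
    then show "X = Z"
      by (intro l2_eqI)
  qed
  have fY: "?f Y = X"
  proof (intro l2_eqI)
    fix j \<alpha>
    have "(?r q)\<^sup>2 * (?v q)\<^sup>2 = 1" for q
      unfolding power_mult_distrib[symmetric] rv by simp
    then show "?f Y $$ j $$ \<alpha> = X $$ j $$ \<alpha>"
      unfolding f[OF Y] using X copies_nth_in[OF X, of j]
      by (auto simp: Y_def tuple_nth shift_op_nth[OF bvv] coord_drop_def copies_def l2_on_def tensor_space_def)
  qed
  have "inv_into ?HN ?f X = Y"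
    by (rule inv_into_f_eq[OF inj Y fY])
  then have "cauchy_dual ?HN (tensor_space k n) ?L X
      = (\<Sum>l\<in>{1..n i}. shift_op k n i ?r [l] (shift_op k n i (\<lambda>q. (?v q)\<^sup>2) [] (X $$ l)))"
    unfolding cauchy_dual_def by (simp add: L Y_def tuple_nth)
  also have "\<dots> = (\<Sum>l\<in>{1..n i}. shift_op k n i ?v [l] (X $$ l))"
  proof (rule sum.cong)
    have "?r q * (?v q)\<^sup>2 = ?v q" for q
      using rv[of q] by (metis mult.assoc mult_1 power2_eq_square)
    then show "shift_op k n i ?r [l] (shift_op k n i (\<lambda>q. (?v q)\<^sup>2) [] (X $$ l)) = shift_op k n i ?v [l] (X $$ l)" for l
      by (subst shift_op_compose[OF br bvv i]) simp
  qed simp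
  finally show ?thesis .
qed

lemma adj_Lam_word:
  assumes m: "m i \<ge> 1" and i: "i \<in> {1..k}" and \<beta>: "\<beta> \<in> free_sg (n i)"
  shows "adj (tensor_space k n) (tensor_space k n) (Lam_word k m n i \<beta>) G
    = coshift_op k n i (shift_weight (m i) (length \<beta>)) (rev \<beta>) G"
proof (rule adj_eqI)
  show "coshift_op k n i (shift_weight (m i) (length \<beta>)) (rev \<beta>) G \<in> tensor_space k n"
    by (intro coshift_op_in bounded_shift_weight m)
  show "cinner (Lam_word k m n i \<beta> F) G = cinner F (coshift_op k n i (shift_weight (m i) (length \<beta>)) (rev \<beta>) G)"
    if "F \<in> tensor_space k n" for F
    unfolding Lam_word_eq_shift_op[where m = m, OF m i that]
    by (rule cinner_shift_op[OF bounded_shift_weight[OF m] i]) (use \<beta> in \<open>simp add: free_sg_def in_lists_conv_set\<close>)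
qed (auto simp: tensor_space_def l2_on_diff)

text \<open>The common diagonal block on the right of the Brown-Halmos identity, with the word
  operators and their adjoints already in shift form; this is where the reversals come from.\<close>

definition bh_sum ::
  "nat \<Rightarrow> (nat \<Rightarrow> nat) \<Rightarrow> (nat \<Rightarrow> nat) \<Rightarrow> nat \<Rightarrow>
    ((nat \<Rightarrow> nat list, 'k::complex_inner) l2 \<Rightarrow> (nat \<Rightarrow> nat list, 'k) l2) \<Rightarrow>
    (nat \<Rightarrow> nat list, 'k) l2 \<Rightarrow> (nat \<Rightarrow> nat list, 'k) l2" where
  "bh_sum k m n i T F = (\<Sum>p\<in>{0..m i - 1}. ((-1) ^ p * real (m i choose (p + 1))) *\<^sub>R
     (\<Sum>\<beta> | \<beta> \<in> free_sg (n i) \<and> length \<beta> = p.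
        shift_op k n i (shift_weight (m i) p) (rev \<beta>) (T (coshift_op k n i (shift_weight (m i) p) (rev \<beta>) F))))"

text \<open>Both sides are linear maps on a finite direct sum, so they agree exactly when all their
  (j, l) blocks do; the right-hand side is block diagonal.\<close>

lemma brown_halmos_iff_bh_sum:
  fixes T :: "(nat \<Rightarrow> nat list, 'k::complex_inner) l2 \<Rightarrow> (nat \<Rightarrow> nat list, 'k) l2"
  assumes m: "\<And>i. i \<in> {1..k} \<Longrightarrow> m i \<ge> 1"
    and T: "bounded_op (tensor_space k n) (tensor_space k n) T"
  shows "brown_halmos k m n T \<longleftrightarrow>
    (\<forall>i\<in>{1..k}. \<forall>j\<in>{1..n i}. \<forall>l\<in>{1..n i}. \<forall>F\<in>tensor_space k n.
       coshift_op k n i (dual_weight (m i)) [j] (T (shift_op k n i (dual_weight (m i)) [l] F))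
         = (if j = l then bh_sum k m n i T F else 0))"
proof -
  let ?H = "tensor_space k n :: (nat \<Rightarrow> nat list, 'k) l2 set"
  have zero_in: "0 \<in> ?H"
    by (simp add: tensor_space_def l2_on_zero)
  have TH: "T F \<in> ?H" if "F \<in> ?H" for F
    using T that unfolding bounded_op_def by blast
  have "(\<forall>X\<in>copies (n i) ?H. adj (copies (n i) ?H) ?H (cauchy_dual (copies (n i) ?H) ?H (Lam_row k m n i))
          (T (cauchy_dual (copies (n i) ?H) ?H (Lam_row k m n i) X)) =
        diag (n i) (\<lambda>F. \<Sum>j\<in>{0..m i - 1}. ((-1) ^ j * of_nat (m i choose (j + 1))) *\<^sub>C
               (\<Sum>\<beta> | \<beta> \<in> free_sg (n i) \<and> length \<beta> = j.
                  Lam_word k m n i \<beta> (T (adj ?H ?H (Lam_word k m n i \<beta>) F)))) X) \<longleftrightarrow>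
     (\<forall>j\<in>{1..n i}. \<forall>l\<in>{1..n i}. \<forall>F\<in>?H.
       coshift_op k n i (dual_weight (m i)) [j] (T (shift_op k n i (dual_weight (m i)) [l] F))
         = (if j = l then bh_sum k m n i T F else 0))" (is "?L \<longleftrightarrow> ?R") if i: "i \<in> {1..k}" for i
  proof -
    note m = m[OF i]
    let ?v = "dual_weight (m i)"
    note bv = bounded_dual_weight[OF m] and br = bounded_shift_weight[OF m]
    define row where "row X = (\<Sum>l\<in>{1..n i}. shift_op k n i ?v [l] (X $$ l))"
      for X :: "(nat, (nat \<Rightarrow> nat list, 'k) l2) l2"
    note cd = cauchy_dual_Lam_row[where m = m and 'k = 'k, OF m i]
    have coef: "((-1) ^ p * of_nat q) *\<^sub>C x = ((-1) ^ p * real q) *\<^sub>R x" for p q and x :: "(nat \<Rightarrow> nat list, 'k) l2"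
      by (simp flip: scaleC_of_real)
    have inner: "Lam_word k m n i \<beta> (T (adj ?H ?H (Lam_word k m n i \<beta>) F)) =
        shift_op k n i (shift_weight (m i) (length \<beta>)) (rev \<beta>) (T (coshift_op k n i (shift_weight (m i) (length \<beta>)) (rev \<beta>) F))"
      if "\<beta> \<in> free_sg (n i)" for \<beta> F
      unfolding adj_Lam_word[where m = m and i = i and n = n, OF m i that]
      by (intro Lam_word_eq_shift_op m i TH coshift_op_in br)
    have "(\<Sum>\<beta> | \<beta> \<in> free_sg (n i) \<and> length \<beta> = p. Lam_word k m n i \<beta> (T (adj ?H ?H (Lam_word k m n i \<beta>) F)))
      = (\<Sum>\<beta> | \<beta> \<in> free_sg (n i) \<and> length \<beta> = p.
        shift_op k n i (shift_weight (m i) p) (rev \<beta>) (T (coshift_op k n i (shift_weight (m i) p) (rev \<beta>) F)))" for p F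
      by (rule sum.cong) (use inner in auto)
    then have Q: "(\<Sum>j\<in>{0..m i - 1}. ((-1) ^ j * of_nat (m i choose (j + 1))) *\<^sub>C
               (\<Sum>\<beta> | \<beta> \<in> free_sg (n i) \<and> length \<beta> = j.
                  Lam_word k m n i \<beta> (T (adj ?H ?H (Lam_word k m n i \<beta>) F)))) = bh_sum k m n i T F" for F
      unfolding bh_sum_def coef by simp
    have "?L \<longleftrightarrow> (\<forall>X\<in>copies (n i) ?H. tuple (n i) (\<lambda>j. coshift_op k n i ?v [j] (T (row X)))
        = tuple (n i) (\<lambda>j. bh_sum k m n i T (X $$ j)))"
      unfolding Q diag_eq_tuple row_def using cd by (simp add: adj_row[OF i bv cd] cong: ball_cong)
    also have "\<dots> \<longleftrightarrow> (\<forall>X\<in>copies (n i) ?H. \<forall>j\<in>{1..n i}. coshift_op k n i ?v [j] (T (row X)) = bh_sum k m n i T (X $$ j))"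
      unfolding tuple_eq_iff ..
    also have "\<dots> \<longleftrightarrow> ?R"
    proof
      assume L: "\<forall>X\<in>copies (n i) ?H. \<forall>j\<in>{1..n i}. coshift_op k n i ?v [j] (T (row X)) = bh_sum k m n i T (X $$ j)"
      show ?R
      proof (intro ballI)
        fix j l F assume jl: "j \<in> {1..n i}" "l \<in> {1..n i}" and F: "F \<in> ?H"
        \<comment> \<open>Placing \<open>F\<close> in copy \<open>l\<close> alone isolates column
          \<open>l\<close> of the block matrix.\<close>
        have "single l F \<in> copies (n i) ?H"
          using jl F by (auto simp: copies_def l2_on_def single_nth tensor_space_def)
        then have "coshift_op k n i ?v [j] (T (row (single l F))) = bh_sum k m n i T (single l F $$ j)"
          using L jl by blast
        moreover have "row (single l F) = (\<Sum>l'\<in>{1..n i}. if l' = l then shift_op k n i ?v [l] F else 0)"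
          unfolding row_def
          by (intro sum.cong) (auto simp: single_nth bounded_op_0[OF bounded_op_shift_op[OF bv, of UNIV]])
        \<comment> \<open>For \<open>j \<noteq> l\<close> the j-th component of the test vector is
          0, so the off-diagonal block must vanish.\<close>
        moreover have "bh_sum k m n i T 0 = 0"
          by (simp add: bh_sum_def bounded_op_0[OF T] zero_in bounded_op_0[OF bounded_op_shift_op[OF br, of UNIV]]
              bounded_op_0[OF bounded_op_coshift_op[OF br, of UNIV]])
        ultimately show "coshift_op k n i ?v [j] (T (shift_op k n i ?v [l] F)) = (if j = l then bh_sum k m n i T F else 0)"
          using jl by (simp add: single_nth)
      qed
    next
      assume R: ?R
      show "\<forall>X\<in>copies (n i) ?H. \<forall>j\<in>{1..n i}. coshift_op k n i ?v [j] (T (row X)) = bh_sum k m n i T (X $$ j)"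
      proof (intro ballI)
        fix X j assume X: "X \<in> copies (n i) ?H" and j: "j \<in> {1..n i}"
        have "coshift_op k n i ?v [j] (T (row X))
          = (\<Sum>l\<in>{1..n i}. coshift_op k n i ?v [j] (T (shift_op k n i ?v [l] (X $$ l))))"
          unfolding row_def
          by (rule bounded_op_sum_arg[OF bounded_op_compose[OF T bounded_op_coshift_op[OF bv], unfolded tensor_space_def]])
            (rule shift_op_in[OF bv, unfolded tensor_space_def])
        also have "\<dots> = (\<Sum>l\<in>{1..n i}. if j = l then bh_sum k m n i T (X $$ l) else 0)"
          by (rule sum.cong) (use R j copies_nth_in[OF X] in auto)
        finally show "coshift_op k n i ?v [j] (T (row X)) = bh_sum k m n i T (X $$ j)"
          using j by simp
      qed
    qed
    finally show ?thesis .
  qed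
  then show ?thesis
    unfolding brown_halmos_def Let_def by simp
qed

section \<open>From operator blocks to scaled matrix entries\<close>

definition entry ::
  "((nat \<Rightarrow> nat list, 'k::complex_inner) l2 \<Rightarrow> (nat \<Rightarrow> nat list, 'k) l2) \<Rightarrow>
    (nat \<Rightarrow> nat list) \<Rightarrow> (nat \<Rightarrow> nat list) \<Rightarrow> 'k \<Rightarrow> 'k" where
  "entry T \<xi> \<gamma> x = T (single \<gamma> x) $$ \<xi>"

definition sqrt_weight :: "nat \<Rightarrow> (nat \<Rightarrow> nat) \<Rightarrow> (nat \<Rightarrow> nat list) \<Rightarrow> real" where
  "sqrt_weight k m \<alpha> = (\<Prod>s\<in>{1..k}. sqrt (bw (m s) (length (\<alpha> s))))"

definition scaled_entry ::
  "nat \<Rightarrow> (nat \<Rightarrow> nat) \<Rightarrow> ((nat \<Rightarrow> nat list, 'k::complex_inner) l2 \<Rightarrow> (nat \<Rightarrow> nat list, 'k) l2) \<Rightarrow>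
    (nat \<Rightarrow> nat list) \<Rightarrow> (nat \<Rightarrow> nat list) \<Rightarrow> 'k \<Rightarrow> 'k" where
  "scaled_entry k m T \<xi> \<gamma> x = (sqrt_weight k m \<xi> * sqrt_weight k m \<gamma>) *\<^sub>R entry T \<xi> \<gamma> x"

lemma sqrt_weight_pos: "(\<And>i. i \<in> {1..k} \<Longrightarrow> m i \<ge> 1) \<Longrightarrow> sqrt_weight k m \<alpha> > 0"
  unfolding sqrt_weight_def by (intro prod_pos) (auto intro: bw_pos)

lemma sqrt_weight_upd:
  assumes "i \<in> {1..k}"
  shows "sqrt_weight k m (\<alpha>(i := a)) * sqrt (bw (m i) (length (\<alpha> i))) = sqrt_weight k m \<alpha> * sqrt (bw (m i) (length a))"
proof -
  have split: "sqrt_weight k m \<beta> = sqrt (bw (m i) (length (\<beta> i))) * (\<Prod>s\<in>{1..k} - {i}. sqrt (bw (m s) (length (\<beta> s))))" for \<beta>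
    unfolding sqrt_weight_def using assms by (intro prod.remove) auto
  have "(\<Prod>s\<in>{1..k} - {i}. sqrt (bw (m s) (length ((\<alpha>(i := a)) s)))) = (\<Prod>s\<in>{1..k} - {i}. sqrt (bw (m s) (length (\<alpha> s))))"
    by (rule prod.cong) auto
  then show ?thesis
    unfolding split by (simp del: fun_upd_apply add: fun_upd_same mult_ac)
qed

text \<open>Only the i-th factor changes, and it changes by the dual weight. The scaling therefore
  absorbs the weights of the Cauchy dual on the left of the identity.\<close>

lemma sqrt_weight_append:
  assumes "i \<in> {1..k}" "m i \<ge> 1"
  shows "sqrt_weight k m (coord_append i [j] \<alpha>) = sqrt_weight k m \<alpha> * dual_weight (m i) (length (\<alpha> i))"
  using sqrt_weight_upd[OF assms(1), of m \<alpha> "\<alpha> i @ [j]"] bw_pos[OF assms(2), of "length (\<alpha> i)"]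
  by (simp add: coord_append_def dual_weight_def real_sqrt_divide field_simps del: fun_upd_apply)

text \<open>The counterpart for the right of the identity: deleting p letters changes the scaling by
  exactly the weight of a p-fold shift.\<close>

lemma sqrt_weight_drop:
  assumes "i \<in> {1..k}" "m i \<ge> 1" "p \<le> length (\<alpha> i)"
  shows "sqrt_weight k m (coord_drop i p \<alpha>) = sqrt_weight k m \<alpha> * shift_weight (m i) p (length (\<alpha> i) - p)"
  using sqrt_weight_upd[OF assms(1), of m \<alpha> "take (length (\<alpha> i) - p) (\<alpha> i)"]
    bw_pos[OF assms(2), of "length (\<alpha> i)"] assms(3)
  by (simp add: coord_drop_def shift_weight_def real_sqrt_divide field_simps min.absorb2 del: fun_upd_apply)

text \<open>At most one word of a given length is a suffix of \<open>a\<close>, so at most one term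
  of the sum is nonzero.\<close>

lemma sum_words_common_suffix:
  assumes "a \<in> free_sg N"
  shows "(\<Sum>\<beta> | \<beta> \<in> free_sg N \<and> length \<beta> = p. if suffix (rev \<beta>) a \<and> suffix (rev \<beta>) b then v else 0)
    = (if \<exists>\<delta>. length \<delta> = p \<and> suffix \<delta> a \<and> suffix \<delta> b then v else (0 :: 'v::real_vector))"
proof (cases "\<exists>\<delta>. length \<delta> = p \<and> suffix \<delta> a \<and> suffix \<delta> b")
  case True
  then obtain \<delta> where \<delta>: "length \<delta> = p" "suffix \<delta> a" "suffix \<delta> b" by blast
  have "rev \<delta> \<in> free_sg N"
    using assms \<delta>(2) by (auto simp: suffix_def free_sg_def in_lists_conv_set)
  moreover have "suffix (rev \<beta>) a \<and> suffix (rev \<beta>) b \<longleftrightarrow> \<beta> = rev \<delta>" if "length \<beta> = p" for \<beta>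
    using \<delta> that by (auto simp: suffix_def)
  moreover have "finite {\<beta>. \<beta> \<in> free_sg N \<and> length \<beta> = p}"
    using finite_lists_length_eq[of "{1..N}" p] by (simp add: free_sg_def lists_eq_set)
  ultimately show ?thesis
    using True \<delta> by (simp add: sum.delta cong: conj_cong)
next
  case False
  then have neg: "\<not> (suffix (rev \<beta>) a \<and> suffix (rev \<beta>) b)" if "length \<beta> = p" for \<beta>
    using that by (metis length_rev)
  show ?thesis
    unfolding if_not_P[OF False] by (rule sum.neutral) (use neg in auto)
qed

text \<open>Each block equation is tested on \<open>single \<gamma> x\<close>, read at \<xi> and
  multiplied by the two square-root weights, which cancels every shift weight. Density of finitely
  supported vectors makes these tests sufficient.\<close>

lemma brown_halmos_iff_scaled_entry:
  fixes T :: "(nat \<Rightarrow> nat list, 'k::complex_inner) l2 \<Rightarrow> (nat \<Rightarrow> nat list, 'k) l2"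
  assumes m: "\<And>i. i \<in> {1..k} \<Longrightarrow> m i \<ge> 1"
    and T: "bounded_op (tensor_space k n) (tensor_space k n) T"
  defines "U \<equiv> scaled_entry k m T"
  shows "brown_halmos k m n T \<longleftrightarrow>
    (\<forall>i\<in>{1..k}. \<forall>j\<in>{1..n i}. \<forall>l\<in>{1..n i}. \<forall>\<xi>\<in>multi_sg k n. \<forall>\<gamma>\<in>multi_sg k n. \<forall>x.
       U (coord_append i [j] \<xi>) (coord_append i [l] \<gamma>) x =
       (if j = l then \<Sum>p\<in>{0..m i - 1}. ((-1) ^ p * real (m i choose (p + 1))) *\<^sub>R
         (if \<exists>\<delta>. length \<delta> = p \<and> suffix \<delta> (\<xi> i) \<and> suffix \<delta> (\<gamma> i)
          then U (coord_drop i p \<xi>) (coord_drop i p \<gamma>) x else 0) else 0))"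
proof -
  let ?H = "tensor_space k n :: (nat \<Rightarrow> nat list, 'k) l2 set"
  have H: "?H = l2_on (multi_sg k n)"
    by (simp add: tensor_space_def)
  have T0: "T 0 = 0"
    by (rule bounded_op_0[OF T]) (simp add: H l2_on_zero)
  have TR: "T (r *\<^sub>R F) = r *\<^sub>R T F" if "F \<in> ?H" for r F
    using T that unfolding bounded_op_def scaleR_scaleC by blast
  have entries: "(\<forall>F\<in>?H. coshift_op k n i (dual_weight (m i)) [j] (T (shift_op k n i (dual_weight (m i)) [l] F))
         = (if j = l then bh_sum k m n i T F else 0)) \<longleftrightarrow>
     (\<forall>\<xi>\<in>multi_sg k n. \<forall>\<gamma>\<in>multi_sg k n. \<forall>x.
       U (coord_append i [j] \<xi>) (coord_append i [l] \<gamma>) x =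
       (if j = l then \<Sum>p\<in>{0..m i - 1}. ((-1) ^ p * real (m i choose (p + 1))) *\<^sub>R
         (if \<exists>\<delta>. length \<delta> = p \<and> suffix \<delta> (\<xi> i) \<and> suffix \<delta> (\<gamma> i)
          then U (coord_drop i p \<xi>) (coord_drop i p \<gamma>) x else 0) else 0))"
    (is "(\<forall>F\<in>?H. ?A F = ?B F) \<longleftrightarrow> (\<forall>\<xi>\<in>_. \<forall>\<gamma>\<in>_. \<forall>x. ?a \<xi> \<gamma> x = ?b \<xi> \<gamma> x)")
    if i: "i \<in> {1..k}" and j: "j \<in> {1..n i}" and l: "l \<in> {1..n i}" for i j l
  proof -
    note mi = m[OF i]
    note bv = bounded_dual_weight[OF mi] and br = bounded_shift_weight[OF mi]
    have words: "[j] \<in> free_sg (n i)" "[l] \<in> free_sg (n i)"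
      using j l by (auto simp: free_sg_def)
    let ?g = "\<lambda>\<xi> \<gamma>. sqrt_weight k m \<xi> * sqrt_weight k m \<gamma>"
    have g: "?g \<xi> \<gamma> \<noteq> 0" for \<xi> \<gamma>
      using sqrt_weight_pos[of k m, OF m] by (metis less_irrefl mult_eq_0_iff)
    have a: "?g \<xi> \<gamma> *\<^sub>R (?A (single \<gamma> x) $$ \<xi>) = ?a \<xi> \<gamma> x"
      if "\<xi> \<in> multi_sg k n" "\<gamma> \<in> multi_sg k n" for \<xi> \<gamma> x
      using that coord_append_multi_sg[OF that(2) i words(2)]
      by (simp add: coshift_op_nth[OF bv] shift_op_single[where n = n, OF bv i words(2)] TR H single_in_l2_on
          U_def scaled_entry_def entry_def sqrt_weight_append[where m = m, OF i mi] mult_ac)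
    \<comment> \<open>The coshift strips the column word and reading the shift at \<xi> strips the
      row word, so a term contributes only if both words end in \<open>rev \<beta>\<close>.\<close>
    have drop: "?g \<xi> \<gamma> *\<^sub>R (shift_op k n i (shift_weight (m i) p) (rev \<beta>) (T (coshift_op k n i (shift_weight (m i) p) (rev \<beta>) (single \<gamma> x))) $$ \<xi>)
      = (if suffix (rev \<beta>) (\<xi> i) \<and> suffix (rev \<beta>) (\<gamma> i) then U (coord_drop i p \<xi>) (coord_drop i p \<gamma>) x else 0)"
      if "\<xi> \<in> multi_sg k n" "\<gamma> \<in> multi_sg k n" "\<beta> \<in> free_sg (n i)" "length \<beta> = p" for \<xi> \<gamma> x \<beta> p
    proof -
      have \<beta>: "rev \<beta> \<in> free_sg (n i)"
        using that(3) by (simp add: free_sg_def in_lists_conv_set)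
      have "p \<le> length \<alpha>" if "suffix (rev \<beta>) \<alpha>" for \<alpha>
        using suffix_length_le[OF that] \<open>length \<beta> = p\<close> by simp
      then show ?thesis
        using that(1,2,4) coord_drop_multi_sg[OF \<open>\<gamma> \<in> multi_sg k n\<close> i]
        by (simp add: shift_op_nth[OF br] coshift_op_single[where n = n, OF br i \<beta>] TR T0 H single_in_l2_on
            U_def scaled_entry_def entry_def sqrt_weight_drop[where m = m, OF i mi] mult_ac)
    qed
    have b: "?g \<xi> \<gamma> *\<^sub>R (?B (single \<gamma> x) $$ \<xi>) = ?b \<xi> \<gamma> x"
      if "\<xi> \<in> multi_sg k n" "\<gamma> \<in> multi_sg k n" for \<xi> \<gamma> x
    proof -
      have "?g \<xi> \<gamma> *\<^sub>R (bh_sum k m n i T (single \<gamma> x) $$ \<xi>)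
        = (\<Sum>p\<in>{0..m i - 1}. ((-1) ^ p * real (m i choose (p + 1))) *\<^sub>R
         (\<Sum>\<beta> | \<beta> \<in> free_sg (n i) \<and> length \<beta> = p. ?g \<xi> \<gamma> *\<^sub>R
           (shift_op k n i (shift_weight (m i) p) (rev \<beta>) (T (coshift_op k n i (shift_weight (m i) p) (rev \<beta>) (single \<gamma> x))) $$ \<xi>)))"
        by (simp add: bh_sum_def l2_sum_nth scaleR_sum_right mult_ac)
      also have "\<dots> = (\<Sum>p\<in>{0..m i - 1}. ((-1) ^ p * real (m i choose (p + 1))) *\<^sub>R
         (\<Sum>\<beta> | \<beta> \<in> free_sg (n i) \<and> length \<beta> = p.
           if suffix (rev \<beta>) (\<xi> i) \<and> suffix (rev \<beta>) (\<gamma> i) then U (coord_drop i p \<xi>) (coord_drop i p \<gamma>) x else 0))"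
        by (intro sum.cong refl arg_cong2[where f = scaleR]) (use drop that in auto)
      finally show ?thesis
        unfolding sum_words_common_suffix[OF multi_sg_coord[OF that(1) i]] by simp
    qed
    have A: "bounded_op (l2_on (multi_sg k n)) (l2_on (multi_sg k n)) ?A"
      unfolding H[symmetric]
      by (rule bounded_op_compose[OF bounded_op_compose[OF bounded_op_shift_op[OF bv] T] bounded_op_coshift_op[OF bv]])
    have "bounded_op (l2_on (multi_sg k n)) UNIV (bh_sum k m n i T)"
      unfolding bh_sum_def
      by (intro bounded_op_sum bounded_op_scaleR bounded_op_UNIV[OF bounded_op_compose[OF
            bounded_op_compose[OF bounded_op_coshift_op[OF br] T] bounded_op_shift_op[OF br]]])
    then have B: "bounded_op (l2_on (multi_sg k n)) UNIV ?B"
      by (cases "j = l") (simp_all add: bounded_op_zero)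
    have "bh_sum k m n i T F $$ \<xi> = 0" if "\<xi> \<notin> multi_sg k n" for F \<xi>
      using that by (simp add: bh_sum_def l2_sum_nth shift_op_nth[OF br])
    \<comment> \<open>Off the admissible multi-words both sides vanish, so comparing entries on
      \<open>multi_sg k n\<close> gives equality of vectors.\<close>
    then have off: "?A F $$ \<xi> = ?B F $$ \<xi>" if "\<xi> \<notin> multi_sg k n" for F \<xi>
      using that by (auto simp: coshift_op_nth[OF bv])
    have eq: "?A (single \<gamma> x) $$ \<xi> = ?B (single \<gamma> x) $$ \<xi> \<longleftrightarrow> ?a \<xi> \<gamma> x = ?b \<xi> \<gamma> x"
      if "\<xi> \<in> multi_sg k n" "\<gamma> \<in> multi_sg k n" for \<xi> \<gamma> x
      unfolding a[OF that, symmetric] b[OF that, symmetric] using g by simp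
    show ?thesis
    proof
      assume L: "\<forall>F\<in>?H. ?A F = ?B F"
      show "\<forall>\<xi>\<in>multi_sg k n. \<forall>\<gamma>\<in>multi_sg k n. \<forall>x. ?a \<xi> \<gamma> x = ?b \<xi> \<gamma> x"
      proof (intro ballI allI)
        fix \<xi> \<gamma> x assume "\<xi> \<in> multi_sg k n" "\<gamma> \<in> multi_sg k n"
        moreover from this have "?A (single \<gamma> x) = ?B (single \<gamma> x)"
          by (intro L[rule_format]) (simp add: H single_in_l2_on)
        ultimately show "?a \<xi> \<gamma> x = ?b \<xi> \<gamma> x"
          by (subst eq[symmetric]) simp_all
      qed
    next
      assume R: "\<forall>\<xi>\<in>multi_sg k n. \<forall>\<gamma>\<in>multi_sg k n. \<forall>x. ?a \<xi> \<gamma> x = ?b \<xi> \<gamma> x"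
      have "?A (single \<gamma> x) = ?B (single \<gamma> x)" if "\<gamma> \<in> multi_sg k n" for \<gamma> x
      proof (rule l2_eqI)
        fix \<xi>
        show "?A (single \<gamma> x) $$ \<xi> = ?B (single \<gamma> x) $$ \<xi>"
        proof (cases "\<xi> \<in> multi_sg k n")
          case True
          show ?thesis
            by (rule eq[OF True that, THEN iffD2]) (rule R[rule_format, OF True that])
        qed (rule off)
      qed
      from bounded_op_eq_on_l2_on[OF bounded_op_UNIV[OF A] B this] show "\<forall>F\<in>?H. ?A F = ?B F"
        unfolding H by blast
    qed
  qed
  show ?thesis
    by (rule trans, rule brown_halmos_iff_bh_sum[OF _ T], erule m) (intro ball_cong refl entries)
qed

section \<open>Reduced pairs, and passing between coordinatewise and product formulas\<close>

section \<open>Reduction of comparable pairs\<close>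

text \<open>A total form of \<open>rdiff\<close> with default [], so that \<open>s_map\<close> is
  \<open>rquot\<close> taken in both orders in every coordinate.\<close>

definition rquot :: "'a list \<Rightarrow> 'a list \<Rightarrow> 'a list" where
  "rquot a b = (if suffix b a then take (length a - length b) a else [])"

lemma s_map_eq:
  "s_map k \<xi> \<gamma> = ((\<lambda>i\<in>{1..k}. rquot (\<xi> i) (\<gamma> i)), (\<lambda>i\<in>{1..k}. rquot (\<gamma> i) (\<xi> i)))"
proof -
  have "rdiff a b = take (length a - length b) a" if "suffix b a" for a b
    unfolding rdiff_def using that by (intro the_equality) (auto simp: suffix_def)
  then show ?thesis
    by (auto simp: s_map_def rquot_def fun_eq_iff)
qed

text \<open>For comparable words one of the two quotients is empty, so reducing a second time
  changes nothing.\<close>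

lemma rquot_rquot: "suffix b a \<or> suffix a b \<Longrightarrow> rquot (rquot a b) (rquot b a) = rquot a b"
  by (auto simp: rquot_def suffix_def)

lemma rmin_rquot: "suffix b a \<or> suffix a b \<Longrightarrow> rmin (rquot a b) (rquot b a) = []"
  by (auto simp: rquot_def suffix_def rmin_def)

lemma comparable_rquot:
  "suffix b a \<or> suffix a b \<Longrightarrow> suffix (rquot b a) (rquot a b) \<or> suffix (rquot a b) (rquot b a)"
  by (auto simp: rquot_def suffix_def)

lemma rquot_free_sg: "a \<in> free_sg N \<Longrightarrow> rquot a b \<in> free_sg N"
  by (auto simp: rquot_def free_sg_def dest: in_set_takeD)

text \<open>Frees the i-th words while the other coordinates stay fixed, which is the shape the
  one-coordinate recurrence needs.\<close>

lemma all_multi_sg_upd: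
  assumes i: "i \<in> {1..k}"
  shows "(\<forall>\<xi>\<in>multi_sg k n. \<forall>\<gamma>\<in>multi_sg k n. P \<xi> \<gamma>) \<longleftrightarrow>
    (\<forall>\<xi>\<in>multi_sg k n. \<forall>\<gamma>\<in>multi_sg k n. \<forall>a\<in>free_sg (n i). \<forall>b\<in>free_sg (n i). P (\<xi>(i := a)) (\<gamma>(i := b)))"
    (is "?L \<longleftrightarrow> ?R")
proof
  assume L: ?L
  show ?R
    by (intro ballI L[rule_format]) (simp_all only: multi_sg_upd[OF _ i])
next
  assume R: ?R
  show ?L
  proof (intro ballI)
    fix \<xi> \<gamma> assume M: "\<xi> \<in> multi_sg k n" "\<gamma> \<in> multi_sg k n"
    have "P (\<xi>(i := \<xi> i)) (\<gamma>(i := \<gamma> i))"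
      using R M M[THEN multi_sg_coord, OF i] by blast
    then show "P \<xi> \<gamma>"
      by simp
  qed
qed

text \<open>With x and all words except the i-th ones fixed, the i-th family of equations is
  precisely the recurrence of \<open>common_suffix_recurrence_iff\<close>, which is replaced by its
  solution.\<close>

lemma brown_halmos_iff_coordinatewise:
  fixes T :: "(nat \<Rightarrow> nat list, 'k::complex_inner) l2 \<Rightarrow> (nat \<Rightarrow> nat list, 'k) l2"
  assumes m: "\<And>i. i \<in> {1..k} \<Longrightarrow> m i \<ge> 1"
    and T: "bounded_op (tensor_space k n) (tensor_space k n) T"
  defines "U \<equiv> scaled_entry k m T"
  shows "brown_halmos k m n T \<longleftrightarrow>
    (\<forall>i\<in>{1..k}. \<forall>x. \<forall>\<xi>\<in>multi_sg k n. \<forall>\<gamma>\<in>multi_sg k n. U \<xi> \<gamma> x =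
      (if suffix (\<gamma> i) (\<xi> i) \<or> suffix (\<xi> i) (\<gamma> i)
       then bw (m i) (length (rmin (\<xi> i) (\<gamma> i))) *\<^sub>R U (\<xi>(i := rquot (\<xi> i) (\<gamma> i))) (\<gamma>(i := rquot (\<gamma> i) (\<xi> i))) x
       else 0))"
proof -
  have "(\<forall>j\<in>{1..n i}. \<forall>l\<in>{1..n i}. \<forall>\<xi>\<in>multi_sg k n. \<forall>\<gamma>\<in>multi_sg k n. \<forall>x.
       U (coord_append i [j] \<xi>) (coord_append i [l] \<gamma>) x =
       (if j = l then \<Sum>p\<in>{0..m i - 1}. ((-1) ^ p * real (m i choose (p + 1))) *\<^sub>R
         (if \<exists>\<delta>. length \<delta> = p \<and> suffix \<delta> (\<xi> i) \<and> suffix \<delta> (\<gamma> i)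
          then U (coord_drop i p \<xi>) (coord_drop i p \<gamma>) x else 0) else 0)) \<longleftrightarrow>
    (\<forall>x. \<forall>\<xi>\<in>multi_sg k n. \<forall>\<gamma>\<in>multi_sg k n. U \<xi> \<gamma> x =
      (if suffix (\<gamma> i) (\<xi> i) \<or> suffix (\<xi> i) (\<gamma> i)
       then bw (m i) (length (rmin (\<xi> i) (\<gamma> i))) *\<^sub>R U (\<xi>(i := rquot (\<xi> i) (\<gamma> i))) (\<gamma>(i := rquot (\<gamma> i) (\<xi> i))) x
       else 0))" (is "(\<forall>j\<in>_. \<forall>l\<in>_. \<forall>\<xi>\<in>_. \<forall>\<gamma>\<in>_. \<forall>x. ?P j l x \<xi> \<gamma>) \<longleftrightarrow> (\<forall>x. \<forall>\<xi>\<in>_. \<forall>\<gamma>\<in>_. ?Q x \<xi> \<gamma>)")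
    if i: "i \<in> {1..k}" for i
  proof -
    let ?M = "multi_sg k n" and ?F = "free_sg (n i)"
    have word: "(\<forall>a\<in>?F. \<forall>b\<in>?F. \<forall>j\<in>{1..n i}. \<forall>l\<in>{1..n i}. ?P j l x (\<xi>(i := a)) (\<gamma>(i := b))) \<longleftrightarrow>
      (\<forall>a\<in>?F. \<forall>b\<in>?F. ?Q x (\<xi>(i := a)) (\<gamma>(i := b)))" for x \<xi> \<gamma>
    proof -
      \<comment> \<open>If both suffix relations hold, the words are equal and both quotients are
        empty, so the symmetric form agrees with the nested conditional.\<close>
      have Q: "(if suffix b a \<or> suffix a b
          then bw (m i) (length (rmin a b)) *\<^sub>R U (\<xi>(i := rquot a b)) (\<gamma>(i := rquot b a)) x else 0) =
        (if suffix b a then bw (m i) (length b) *\<^sub>R U (\<xi>(i := take (length a - length b) a)) (\<gamma>(i := [])) x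
         else if suffix a b then bw (m i) (length a) *\<^sub>R U (\<xi>(i := [])) (\<gamma>(i := take (length b - length a) b)) x
         else 0)" for a b
        by (auto simp: rmin_def rquot_def dest: suffix_order.antisym)
      have upd: "coord_append i \<delta> (\<alpha>(i := a)) = \<alpha>(i := a @ \<delta>)"
        "coord_drop i p (\<alpha>(i := a)) = \<alpha>(i := take (length a - p) a)" for \<alpha> :: "nat \<Rightarrow> nat list" and \<delta> a p
        by (simp_all add: coord_append_def coord_drop_def)
      show ?thesis
        unfolding fun_upd_same fun_upd_upd Q upd free_sg_def by (rule common_suffix_recurrence_iff[OF m[OF i]])
    qed
    have swap: "(\<forall>j\<in>J. \<forall>l\<in>J. \<forall>\<xi>\<in>M. \<forall>\<gamma>\<in>M. \<forall>x. P j l x \<xi> \<gamma>) \<longleftrightarrow>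
      (\<forall>x. \<forall>\<xi>\<in>M. \<forall>\<gamma>\<in>M. \<forall>j\<in>J. \<forall>l\<in>J. P j l x \<xi> \<gamma>)" for J :: "nat set" and M :: "(nat \<Rightarrow> nat list) set"
      and P :: "nat \<Rightarrow> nat \<Rightarrow> 'k \<Rightarrow> (nat \<Rightarrow> nat list) \<Rightarrow> (nat \<Rightarrow> nat list) \<Rightarrow> bool"
      by blast
    have "(\<forall>j\<in>{1..n i}. \<forall>l\<in>{1..n i}. \<forall>\<xi>\<in>?M. \<forall>\<gamma>\<in>?M. \<forall>x. ?P j l x \<xi> \<gamma>) \<longleftrightarrow>
      (\<forall>x. \<forall>\<xi>\<in>?M. \<forall>\<gamma>\<in>?M. \<forall>j\<in>{1..n i}. \<forall>l\<in>{1..n i}. ?P j l x \<xi> \<gamma>)"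
      by (rule swap)
    also have "\<dots> \<longleftrightarrow> (\<forall>x. \<forall>\<xi>\<in>?M. \<forall>\<gamma>\<in>?M. \<forall>a\<in>?F. \<forall>b\<in>?F. \<forall>j\<in>{1..n i}. \<forall>l\<in>{1..n i}. ?P j l x (\<xi>(i := a)) (\<gamma>(i := b)))"
      by (rule all_cong1) (rule all_multi_sg_upd[OF i])
    also have "\<dots> \<longleftrightarrow> (\<forall>x. \<forall>\<xi>\<in>?M. \<forall>\<gamma>\<in>?M. \<forall>a\<in>?F. \<forall>b\<in>?F. ?Q x (\<xi>(i := a)) (\<gamma>(i := b)))"
      by (rule all_cong1, rule ball_cong[OF refl], rule ball_cong[OF refl]) (rule word)
    also have "\<dots> \<longleftrightarrow> (\<forall>x. \<forall>\<xi>\<in>?M. \<forall>\<gamma>\<in>?M. ?Q x \<xi> \<gamma>)"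
      by (rule all_cong1) (rule all_multi_sg_upd[OF i, symmetric])
    finally show ?thesis .
  qed
  then show ?thesis
    unfolding U_def
    by (intro trans[OF brown_halmos_iff_scaled_entry[OF m T]] ball_cong refl)
qed

text \<open>In each coordinate \<open>rmin\<close> and \<open>rmax\<close> are the two given words
  in some order, comparable or not, and sqrt(x / y) sqrt(x) sqrt(y) = x for positive x and
  y.\<close>

lemma tau_sqrt_weight:
  assumes m: "\<And>i. i \<in> {1..k} \<Longrightarrow> m i \<ge> 1"
  shows "tau k m \<xi> \<gamma> * (sqrt_weight k m \<xi> * sqrt_weight k m \<gamma>)
    = (\<Prod>i\<in>{1..k}. bw (m i) (length (rmin (\<xi> i) (\<gamma> i))))"
  unfolding tau_def sqrt_weight_def prod.distrib[symmetric]
proof (rule prod.cong)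
  fix i assume "i \<in> {1..k}"
  note pos = bw_pos[OF m[OF this]]
  have s: "sqrt (x / y) * (sqrt x * sqrt y) = x" "sqrt (x / y) * (sqrt y * sqrt x) = x"
    if "x > 0" "y > 0" for x y :: real
    using that by (simp_all add: real_sqrt_divide)
  show "sqrt (b_weight (m i) (rmin (\<xi> i) (\<gamma> i)) / b_weight (m i) (rmax (\<xi> i) (\<gamma> i))) *
      (sqrt (bw (m i) (length (\<xi> i))) * sqrt (bw (m i) (length (\<gamma> i))))
    = bw (m i) (length (rmin (\<xi> i) (\<gamma> i)))"
    unfolding b_weight_eq_bw
    by (cases "suffix (\<gamma> i) (\<xi> i)") (simp_all only: rmin_def rmax_def if_True if_False s[OF pos pos])
qed simp

lemma ptensor_ket_eq_single:
  assumes "\<gamma> \<in> multi_sg k n"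
  shows "ptensor k n x (\<lambda>i. ket (\<gamma> i)) = single \<gamma> x"
proof (rule cinner_eqI)
  fix F
  have "cinner F (single \<gamma> x) = (\<Sum>\<^sub>\<infinity>\<alpha>\<in>{\<gamma>}. cinner (F $$ \<alpha>) x)"
    unfolding cinner_l2_def by (rule infsum_cong_neutral) (auto simp: single_nth)
  then have "cinner F (ptensor k n x (\<lambda>i. ket (\<gamma> i))) = cinner F (single \<gamma> x)"
    by (simp add: cinner_ptensor_ket[OF assms])
  then show "cinner (ptensor k n x (\<lambda>i. ket (\<gamma> i))) F = cinner (single \<gamma> x) F"
    by (metis cinner_commute)
qed

text \<open>Quantifying over y turns the scalar identities into vector identities. Multiplying by
  the nonzero scaling then replaces \<open>tau\<close> by the weights of the minima.\<close>

lemma weighted_multi_Toeplitz_iff_scaled_entry: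
  fixes T :: "(nat \<Rightarrow> nat list, 'k::complex_inner) l2 \<Rightarrow> (nat \<Rightarrow> nat list, 'k) l2"
  assumes m: "\<And>i. i \<in> {1..k} \<Longrightarrow> m i \<ge> 1"
  shows "weighted_multi_Toeplitz k m n T \<longleftrightarrow>
    (\<exists>A. (\<forall>p\<in>J_pairs k n. bounded_op UNIV UNIV (A p)) \<and>
      (\<forall>\<xi>\<in>multi_sg k n. \<forall>\<gamma>\<in>multi_sg k n. \<forall>x. scaled_entry k m T \<xi> \<gamma> x =
        (if (\<xi>, \<gamma>) \<in> comparable_pairs k n
         then (\<Prod>i\<in>{1..k}. bw (m i) (length (rmin (\<xi> i) (\<gamma> i)))) *\<^sub>R A (s_map k \<xi> \<gamma>) x else 0)))"
proof -
  have "(\<forall>y. cinner (T (ptensor k n x (\<lambda>i. ket (\<gamma> i)))) (ptensor k n y (\<lambda>i. ket (\<xi> i))) =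
      (if (\<xi>, \<gamma>) \<in> comparable_pairs k n
       then complex_of_real (tau k m \<xi> \<gamma>) * cinner (A (s_map k \<xi> \<gamma>) x) y else 0)) \<longleftrightarrow>
    scaled_entry k m T \<xi> \<gamma> x =
      (if (\<xi>, \<gamma>) \<in> comparable_pairs k n
       then (\<Prod>i\<in>{1..k}. bw (m i) (length (rmin (\<xi> i) (\<gamma> i)))) *\<^sub>R A (s_map k \<xi> \<gamma>) x else 0)"
    if "\<xi> \<in> multi_sg k n" "\<gamma> \<in> multi_sg k n" for A \<xi> \<gamma> x
  proof -
    let ?R = "if (\<xi>, \<gamma>) \<in> comparable_pairs k n then tau k m \<xi> \<gamma> *\<^sub>R A (s_map k \<xi> \<gamma>) x else 0"
    let ?g = "sqrt_weight k m \<xi> * sqrt_weight k m \<gamma>"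
    have tau: "tau k m \<xi> \<gamma> * ?g = (\<Prod>i\<in>{1..k}. bw (m i) (length (rmin (\<xi> i) (\<gamma> i))))"
      by (rule tau_sqrt_weight) (rule m)
    have g: "?g \<noteq> 0"
      using sqrt_weight_pos[of k m, OF m] by (metis less_irrefl mult_eq_0_iff)
    have "(\<forall>y. cinner (T (ptensor k n x (\<lambda>i. ket (\<gamma> i)))) (ptensor k n y (\<lambda>i. ket (\<xi> i))) =
      (if (\<xi>, \<gamma>) \<in> comparable_pairs k n
       then complex_of_real (tau k m \<xi> \<gamma>) * cinner (A (s_map k \<xi> \<gamma>) x) y else 0))
      \<longleftrightarrow> (\<forall>y. cinner (entry T \<xi> \<gamma> x) y = cinner ?R y)"
      unfolding cinner_ptensor_ket[OF that(1)] ptensor_ket_eq_single[OF that(2)]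
      by (simp add: entry_def cinner_scaleR_left)
    also have "\<dots> \<longleftrightarrow> entry T \<xi> \<gamma> x = ?R"
      by (auto intro: cinner_eqI)
    also have "\<dots> \<longleftrightarrow> ?g *\<^sub>R entry T \<xi> \<gamma> x = ?g *\<^sub>R ?R"
      using g by simp
    also have "?g *\<^sub>R ?R = (if (\<xi>, \<gamma>) \<in> comparable_pairs k n
       then (\<Prod>i\<in>{1..k}. bw (m i) (length (rmin (\<xi> i) (\<gamma> i)))) *\<^sub>R A (s_map k \<xi> \<gamma>) x else 0)"
      unfolding tau[symmetric] by (simp add: mult_ac)
    finally show ?thesis
      unfolding scaled_entry_def .
  qed
  then show ?thesis
    unfolding weighted_multi_Toeplitz_def by (simp cong: ball_cong)
qed

lemma bounded_op_scaled_entry: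
  assumes T: "bounded_op (tensor_space k n) (tensor_space k n) T" and \<gamma>: "\<gamma> \<in> multi_sg k n"
  shows "bounded_op UNIV UNIV (scaled_entry k m T \<xi> \<gamma>)"
proof -
  have "bounded_op UNIV UNIV (entry T \<xi> \<gamma>)"
    using bounded_op_compose[OF bounded_op_compose[OF bounded_op_single[OF \<gamma>] bounded_op_UNIV[OF T[unfolded tensor_space_def]]]
        bounded_op_l2_nth]
    unfolding entry_def .
  then show ?thesis
    unfolding scaled_entry_def by (rule bounded_op_scaleR)
qed

text \<open>Coordinates are reduced one at a time, each contributing its own weight; a single
  incomparable coordinate already makes the entry zero.\<close>

lemma coordinatewise_imp_product:
  fixes U :: "(nat \<Rightarrow> nat list) \<Rightarrow> (nat \<Rightarrow> nat list) \<Rightarrow> 'v::real_vector"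
  assumes step: "\<And>i \<xi> \<gamma>. i \<in> {1..k} \<Longrightarrow> \<xi> \<in> multi_sg k n \<Longrightarrow> \<gamma> \<in> multi_sg k n \<Longrightarrow> U \<xi> \<gamma> =
      (if suffix (\<gamma> i) (\<xi> i) \<or> suffix (\<xi> i) (\<gamma> i)
       then bw (m i) (length (rmin (\<xi> i) (\<gamma> i))) *\<^sub>R U (\<xi>(i := rquot (\<xi> i) (\<gamma> i))) (\<gamma>(i := rquot (\<gamma> i) (\<xi> i)))
       else 0)"
    and \<xi>: "\<xi> \<in> multi_sg k n" and \<gamma>: "\<gamma> \<in> multi_sg k n"
  shows "U \<xi> \<gamma> = (if (\<xi>, \<gamma>) \<in> comparable_pairs k n
    then (\<Prod>i\<in>{1..k}. bw (m i) (length (rmin (\<xi> i) (\<gamma> i)))) *\<^sub>R U (fst (s_map k \<xi> \<gamma>)) (snd (s_map k \<xi> \<gamma>)) else 0)"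
proof (cases "(\<xi>, \<gamma>) \<in> comparable_pairs k n")
  case False
  then obtain i where "i \<in> {1..k}" "\<not> (suffix (\<gamma> i) (\<xi> i) \<or> suffix (\<xi> i) (\<gamma> i))"
    using \<xi> \<gamma> by (auto simp: comparable_pairs_def)
  then show ?thesis
    using False step[OF _ \<xi> \<gamma>, of i] by simp
next
  case True
  let ?\<sigma> = "fst (s_map k \<xi> \<gamma>)" and ?\<beta> = "snd (s_map k \<xi> \<gamma>)"
  \<comment> \<open>Invariant: the coordinates in \<open>J\<close> are already reduced and the
    others untouched. Membership in \<open>multi_sg k n\<close> is carried along so that
    \<open>step\<close> can be applied again.\<close>
  have "override_on \<xi> ?\<sigma> J \<in> multi_sg k n \<and> override_on \<gamma> ?\<beta> J \<in> multi_sg k n \<and>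
    U \<xi> \<gamma> = (\<Prod>i\<in>J. bw (m i) (length (rmin (\<xi> i) (\<gamma> i)))) *\<^sub>R U (override_on \<xi> ?\<sigma> J) (override_on \<gamma> ?\<beta> J)"
    if "J \<subseteq> {1..k}" for J
    using finite_subset[OF that finite_atLeastAtMost] that
  proof (induction J rule: finite_induct)
    case empty
    then show ?case
      using \<xi> \<gamma> by simp
  next
    case (insert i J)
    then have i: "i \<in> {1..k}" and J: "override_on \<xi> ?\<sigma> J \<in> multi_sg k n" "override_on \<gamma> ?\<beta> J \<in> multi_sg k n"
      "U \<xi> \<gamma> = (\<Prod>i\<in>J. bw (m i) (length (rmin (\<xi> i) (\<gamma> i)))) *\<^sub>R U (override_on \<xi> ?\<sigma> J) (override_on \<gamma> ?\<beta> J)"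
      by auto
    have at: "override_on \<xi> ?\<sigma> J i = \<xi> i" "override_on \<gamma> ?\<beta> J i = \<gamma> i"
      using insert.hyps(2) by simp_all
    have ins: "override_on \<xi> ?\<sigma> (insert i J) = (override_on \<xi> ?\<sigma> J)(i := rquot (\<xi> i) (\<gamma> i))"
      "override_on \<gamma> ?\<beta> (insert i J) = (override_on \<gamma> ?\<beta> J)(i := rquot (\<gamma> i) (\<xi> i))"
      using i by (simp_all only: override_on_insert s_map_eq fst_conv snd_conv restrict_apply if_True)
    have "suffix (\<gamma> i) (\<xi> i) \<or> suffix (\<xi> i) (\<gamma> i)"
      using True i by (auto simp: comparable_pairs_def)
    then have "U (override_on \<xi> ?\<sigma> J) (override_on \<gamma> ?\<beta> J) = bw (m i) (length (rmin (\<xi> i) (\<gamma> i))) *\<^sub>R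
        U (override_on \<xi> ?\<sigma> (insert i J)) (override_on \<gamma> ?\<beta> (insert i J))"
      unfolding ins using step[OF i J(1,2)] by (simp only: at if_True)
    moreover have "rquot (\<xi> i) (\<gamma> i) \<in> free_sg (n i)" "rquot (\<gamma> i) (\<xi> i) \<in> free_sg (n i)"
      by (rule rquot_free_sg, rule multi_sg_coord[OF \<xi> i], rule rquot_free_sg, rule multi_sg_coord[OF \<gamma> i])
    ultimately show ?case
      unfolding ins using J insert.hyps multi_sg_upd[OF J(1) i] multi_sg_upd[OF J(2) i]
      by (simp only: prod.insert[OF insert.hyps(1,2)] scaleR_scaleR mult.commute simp_thms)
  qed
  from this[OF subset_refl] have "U \<xi> \<gamma> = (\<Prod>i\<in>{1..k}. bw (m i) (length (rmin (\<xi> i) (\<gamma> i)))) *\<^sub>R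
      U (override_on \<xi> ?\<sigma> {1..k}) (override_on \<gamma> ?\<beta> {1..k})"
    by blast
  \<comment> \<open>Outside \<open>{1..k}\<close> all four families take the value
    \<open>undefined\<close>, so overriding on \<open>{1..k}\<close> leaves nothing of the original
    words.\<close>
  moreover have "override_on \<xi> ?\<sigma> {1..k} = ?\<sigma>" "override_on \<gamma> ?\<beta> {1..k} = ?\<beta>"
    using \<xi> \<gamma> by (auto simp: fun_eq_iff override_on_def s_map_eq multi_sg_def PiE_def extensional_def)
  ultimately show ?thesis
    using True by simp
qed

text \<open>Reducing coordinate i of a pair comparable there preserves comparability and
  \<open>s_map\<close>, and turns the i-th factor of the product into 1.\<close>

lemma product_imp_coordinatewise:
  fixes A :: "(nat \<Rightarrow> nat list) \<times> (nat \<Rightarrow> nat list) \<Rightarrow> 'v::real_vector"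
  assumes U: "\<And>\<xi> \<gamma>. \<xi> \<in> multi_sg k n \<Longrightarrow> \<gamma> \<in> multi_sg k n \<Longrightarrow> U \<xi> \<gamma> =
      (if (\<xi>, \<gamma>) \<in> comparable_pairs k n
       then (\<Prod>i\<in>{1..k}. bw (m i) (length (rmin (\<xi> i) (\<gamma> i)))) *\<^sub>R A (s_map k \<xi> \<gamma>) else 0)"
    and i: "i \<in> {1..k}" and \<xi>: "\<xi> \<in> multi_sg k n" and \<gamma>: "\<gamma> \<in> multi_sg k n"
  shows "U \<xi> \<gamma> = (if suffix (\<gamma> i) (\<xi> i) \<or> suffix (\<xi> i) (\<gamma> i)
       then bw (m i) (length (rmin (\<xi> i) (\<gamma> i))) *\<^sub>R U (\<xi>(i := rquot (\<xi> i) (\<gamma> i))) (\<gamma>(i := rquot (\<gamma> i) (\<xi> i)))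
       else 0)"
proof (cases "suffix (\<gamma> i) (\<xi> i) \<or> suffix (\<xi> i) (\<gamma> i)")
  case False
  then have "(\<xi>, \<gamma>) \<notin> comparable_pairs k n"
    using i by (auto simp: comparable_pairs_def)
  then show ?thesis
    using False U[OF \<xi> \<gamma>] by simp
next
  case True
  define \<xi>' \<gamma>' where d: "\<xi>' = \<xi>(i := rquot (\<xi> i) (\<gamma> i))" "\<gamma>' = \<gamma>(i := rquot (\<gamma> i) (\<xi> i))"
  have M: "\<xi>' \<in> multi_sg k n" "\<gamma>' \<in> multi_sg k n"
    unfolding d using \<xi> \<gamma> i
    by (simp_all only: multi_sg_upd[OF \<xi> i] multi_sg_upd[OF \<gamma> i] rquot_free_sg multi_sg_coord)
  have other: "\<xi>' s = \<xi> s" "\<gamma>' s = \<gamma> s" if "s \<noteq> i" for s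
    using that by (simp_all add: d)
  have at: "\<xi>' i = rquot (\<xi> i) (\<gamma> i)" "\<gamma>' i = rquot (\<gamma> i) (\<xi> i)"
    by (simp_all add: d)
  have "suffix (\<gamma>' s) (\<xi>' s) \<or> suffix (\<xi>' s) (\<gamma>' s) \<longleftrightarrow> suffix (\<gamma> s) (\<xi> s) \<or> suffix (\<xi> s) (\<gamma> s)" for s
    using True comparable_rquot[OF True] by (cases "s = i") (simp_all add: other at)
  then have "(\<xi>', \<gamma>') \<in> comparable_pairs k n \<longleftrightarrow> (\<xi>, \<gamma>) \<in> comparable_pairs k n"
    using M \<xi> \<gamma> by (simp add: comparable_pairs_def)
  moreover have "s_map k \<xi>' \<gamma>' = s_map k \<xi> \<gamma>"
  proof -
    have "rquot (\<xi>' s) (\<gamma>' s) = rquot (\<xi> s) (\<gamma> s)" "rquot (\<gamma>' s) (\<xi>' s) = rquot (\<gamma> s) (\<xi> s)" for s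
      using True by (cases "s = i"; auto simp: other at rquot_rquot)+
    then show ?thesis
      by (simp add: s_map_eq)
  qed
  moreover have "(\<Prod>s\<in>{1..k}. bw (m s) (length (rmin (\<xi> s) (\<gamma> s))))
      = bw (m i) (length (rmin (\<xi> i) (\<gamma> i))) * (\<Prod>s\<in>{1..k}. bw (m s) (length (rmin (\<xi>' s) (\<gamma>' s))))"
  proof -
    have "(\<Prod>s\<in>{1..k} - {i}. bw (m s) (length (rmin (\<xi>' s) (\<gamma>' s)))) = (\<Prod>s\<in>{1..k} - {i}. bw (m s) (length (rmin (\<xi> s) (\<gamma> s))))"
      by (rule prod.cong) (auto simp: other)
    moreover have "bw (m i) (length (rmin (\<xi>' i) (\<gamma>' i))) = 1"
      by (simp add: at rmin_rquot[OF True])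
    ultimately show ?thesis
      by (simp only: prod.remove[OF finite_atLeastAtMost i] mult_1)
  qed
  ultimately show ?thesis
    using True U[OF \<xi> \<gamma>] U[OF M] unfolding d[symmetric] by simp
qed

theorem theorem3p7:
  fixes k :: nat and m n :: "nat \<Rightarrow> nat"
    and T :: "(nat \<Rightarrow> nat list, 'k::chilbert_space) l2 \<Rightarrow> (nat \<Rightarrow> nat list, 'k) l2"
  assumes "k \<ge> 1"
    and "\<And>i. i \<in> {1..k} \<Longrightarrow> m i \<ge> 1"
    and "\<And>i. i \<in> {1..k} \<Longrightarrow> n i \<ge> 1"
    and "separable_space (euclidean :: 'k topology)"
    and "bounded_op (tensor_space k n) (tensor_space k n) T"
  shows "brown_halmos k m n T \<longleftrightarrow> weighted_multi_Toeplitz k m n T"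
proof -
  let ?U = "scaled_entry k m T"
  note coordinatewise = brown_halmos_iff_coordinatewise[OF assms(2,5)]
    and product = weighted_multi_Toeplitz_iff_scaled_entry[OF assms(2)]
  show ?thesis
  proof
    assume "brown_halmos k m n T"
    then have step: "?U \<xi> \<gamma> x =
      (if suffix (\<gamma> i) (\<xi> i) \<or> suffix (\<xi> i) (\<gamma> i)
       then bw (m i) (length (rmin (\<xi> i) (\<gamma> i))) *\<^sub>R ?U (\<xi>(i := rquot (\<xi> i) (\<gamma> i))) (\<gamma>(i := rquot (\<gamma> i) (\<xi> i))) x
       else 0)" if "i \<in> {1..k}" "\<xi> \<in> multi_sg k n" "\<gamma> \<in> multi_sg k n" for i \<xi> \<gamma> x
      using that by (subst (asm) coordinatewise) blast+
    \<comment> \<open>The coefficient operator at a reduced pair is the scaled entry of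
      \<open>T\<close> at that same pair.\<close>
    have "bounded_op UNIV UNIV (?U (fst p) (snd p))" if "p \<in> J_pairs k n" for p
      by (rule bounded_op_scaled_entry[OF assms(5)]) (use that in \<open>auto simp: J_pairs_def comparable_pairs_def\<close>)
    then show "weighted_multi_Toeplitz k m n T"
      using coordinatewise_imp_product[where U = "\<lambda>\<xi> \<gamma>. ?U \<xi> \<gamma> x" for x, OF step]
      by (subst product) (assumption, intro exI[of _ "\<lambda>p. ?U (fst p) (snd p)"], blast)
  next
    assume "weighted_multi_Toeplitz k m n T"
    then obtain A where A: "?U \<xi> \<gamma> x = (if (\<xi>, \<gamma>) \<in> comparable_pairs k n
         then (\<Prod>i\<in>{1..k}. bw (m i) (length (rmin (\<xi> i) (\<gamma> i)))) *\<^sub>R A (s_map k \<xi> \<gamma>) x else 0)"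
      if "\<xi> \<in> multi_sg k n" "\<gamma> \<in> multi_sg k n" for \<xi> \<gamma> x
      by (subst (asm) product) blast+
    show "brown_halmos k m n T"
      \<comment> \<open>For each fixed x the scaled entries and the coefficients are vector-valued
        functions of the pair, to which the converse reduction applies.\<close>
      by (subst coordinatewise, assumption)
        (intro ballI allI product_imp_coordinatewise[where U = "\<lambda>\<xi> \<gamma>. ?U \<xi> \<gamma> x" and A = "\<lambda>p. A p x" for x, OF A])
  qed
qed

end
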